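(* Let $W:[0,1]\to\mathbb C$ be $(\sigma_*,2)$-Gevrey regular, let $0<\sigma<\sigma'<\sigma_*$ and $s\in\Omega_\sigma\cap\Omega_{\sigma'}$. Then $\dim\{u\in\mathcal D^\sigma:\mathcal L_su=0\}=\dim\{u\in\mathcal D^{\sigma'}:\mathcal L_su=0\}$.
   Context: Let $I=(0,1)$. A function $u\in C^\infty(\overline I)$ is $(\sigma,k)$-Gevrey regular ($\sigma,k>0$) if there is $C>0$ with $\sup_{x\in I}|u^{(n)}(x)|\le C\sigma^{-n}(n!)^k$ for all $n\ge0$. For $\sigma>0$, $u\in C^\infty(\overline I)$, $k\in\{0,1,2\}$: $|u|^{0}_{\sigma,k,0}=\big(\sum_{n=0}^\infty\frac{\sigma^{2n}}{n!^2(n+1)!^2}n^{k}\int_0^1(x/\sigma)^k|\partial_x^nu|^2dx\big)^{1/2}$ (with $0^0:=1$), $\|u\|_{\sigma,0,0}=|u|^0_{\sigma,0,0}$, $[u]^0_\sigma=(\sum_{n=0}^\infty\frac{\sigma^{2n+1}}{n!^2(n+1)!^2}|u^{(n)}(0)|^2)^{1/2}$. $X^\sigma=\{u\in C^\infty(\overline I):u(1)=0,\ \|\partial_xu\|_{\sigma,0,0}+|\partial_xu|^0_{\sigma,1,0}+|\partial_xu|^0_{\sigma,2,0}+[\partial_xu]^0_\sigma<\infty\}$, $Y^\sigma=\{u\in C^\infty(\overline I):\|u\|_{\sigma,0,0}+|u|^0_{\sigma,1,0}+[u]^0_\sigma<\infty\}$. $\Omega^1_\sigma=\{s:\Re s\le0,\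 \sigma<|\Im s|\}\cup\{s:\Re s>0,\ \sigma<|s|\}$; $\Omega^2_\sigma=\{s:\ \sigma<|s|+\Re s,\ \sigma>\frac{-\Re(s)|s|}{2(|s|+\Re s)}\}$; $\Omega^3_\sigma=\{s\neq0:\ \sigma(|s|-\sigma+\Re s)-(\sigma(1+\frac{\Re s}{|s|})+\frac12\Re s)^2>0\}$; $\Omega_\sigma=\Omega^1_\sigma\cap(\Omega^2_\sigma\cup\Omega^3_\sigma)$. $\mathcal L_su=\frac{d}{dx}(x^2\frac{du}{dx})+s\frac{du}{dx}-Wu$ and $\mathcal D^\sigma=\{u\in X^\sigma:\mathcal L_su\in Y^\sigma\}$ (independent of $s\in\Omega_\sigma$). It is known that $\mathcal L_s:\mathcal D^\sigma\to Y^\sigma$ is Fredholm of index $0$ for $s\in\Omega_\sigma$. *)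

theory Defs
  imports "HOL-Analysis.Analysis" "HOL-Library.Function_Algebras"
begin

text \<open>Functions on the closed interval I = [0,1] are represented as real => complex.
  D is a family of successive (one-sided at the endpoints) derivatives on [0,1].\<close>

definition derivs_family :: "(real \<Rightarrow> complex) \<Rightarrow> (nat \<Rightarrow> real \<Rightarrow> complex) \<Rightarrow> bool" where
  "derivs_family u D \<longleftrightarrow> (\<forall>x\<in>{0..1}. D 0 x = u x) \<and>
     (\<forall>n. \<forall>x\<in>{0..1}. (D n has_vector_derivative D (Suc n) x) (at x within {0..1}))"

definition smooth_I :: "(real \<Rightarrow> complex) \<Rightarrow> bool" where
  "smooth_I u \<longleftrightarrow> (\<exists>D. derivs_family u D)"

text \<open>n-th derivative on [0,1] (unique there).\<close>
definition dn :: "nat \<Rightarrow> (real \<Rightarrow> complex) \<Rightarrow> real \<Rightarrow> complex" where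
  "dn n u x = (SOME D. derivs_family u D) n x"

text \<open>C^infinity([0,1]) as a space of functions; canonical representatives vanish outside [0,1].\<close>
definition Cinf :: "(real \<Rightarrow> complex) set" where
  "Cinf = {u. smooth_I u \<and> (\<forall>x. x \<notin> {0..1} \<longrightarrow> u x = 0)}"

definition gevrey :: "real \<Rightarrow> real \<Rightarrow> (real \<Rightarrow> complex) \<Rightarrow> bool" where
  "gevrey \<sigma> k u \<longleftrightarrow> smooth_I u \<and>
     (\<exists>C>0. \<forall>n. \<forall>x\<in>{0<..<1}. norm (dn n u x) \<le> C * \<sigma> powr (- real n) * fact n powr k)"

definition dx :: "(real \<Rightarrow> complex) \<Rightarrow> real \<Rightarrow> complex" where
  "dx u = (\<lambda>x. if x \<in> {0..1} then dn 1 u x else 0)"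

text \<open>n-th term of (|u|^0_{sigma,k,0})^2; note 0^0 = 1 in Isabelle.\<close>
definition seminorm_term :: "real \<Rightarrow> nat \<Rightarrow> (real \<Rightarrow> complex) \<Rightarrow> nat \<Rightarrow> real" where
  "seminorm_term \<sigma> k u n = \<sigma> ^ (2*n) / ((fact n)^2 * (fact (n+1))^2) * real n ^ k *
      integral {0..1} (\<lambda>x. (x / \<sigma>) ^ k * (norm (dn n u x))^2)"

definition seminorm_fin :: "real \<Rightarrow> nat \<Rightarrow> (real \<Rightarrow> complex) \<Rightarrow> bool" where
  "seminorm_fin \<sigma> k u \<longleftrightarrow> summable (seminorm_term \<sigma> k u)"

definition seminorm :: "real \<Rightarrow> nat \<Rightarrow> (real \<Rightarrow> complex) \<Rightarrow> real" where
  "seminorm \<sigma> k u = sqrt (suminf (seminorm_term \<sigma> k u))"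

definition bdry_term :: "real \<Rightarrow> (real \<Rightarrow> complex) \<Rightarrow> nat \<Rightarrow> real" where
  "bdry_term \<sigma> u n = \<sigma> ^ (2*n+1) / ((fact n)^2 * (fact (n+1))^2) * (norm (dn n u 0))^2"

definition bdry_fin :: "real \<Rightarrow> (real \<Rightarrow> complex) \<Rightarrow> bool" where
  "bdry_fin \<sigma> u \<longleftrightarrow> summable (bdry_term \<sigma> u)"

definition Xsp :: "real \<Rightarrow> (real \<Rightarrow> complex) set" where
  "Xsp \<sigma> = {u \<in> Cinf. u 1 = 0 \<and> seminorm_fin \<sigma> 0 (dx u) \<and> seminorm_fin \<sigma> 1 (dx u)
              \<and> seminorm_fin \<sigma> 2 (dx u) \<and> bdry_fin \<sigma> (dx u)}"

definition Ysp :: "real \<Rightarrow> (real \<Rightarrow> complex) set" where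
  "Ysp \<sigma> = {u \<in> Cinf. seminorm_fin \<sigma> 0 u \<and> seminorm_fin \<sigma> 1 u \<and> bdry_fin \<sigma> u}"

definition Lop :: "(real \<Rightarrow> complex) \<Rightarrow> complex \<Rightarrow> (real \<Rightarrow> complex) \<Rightarrow> real \<Rightarrow> complex" where
  "Lop W s u = (\<lambda>x. if x \<in> {0..1} then
      dn 1 (\<lambda>y. complex_of_real (y^2) * dn 1 u y) x + s * dn 1 u x - W x * u x else 0)"

definition Dsp :: "(real \<Rightarrow> complex) \<Rightarrow> complex \<Rightarrow> real \<Rightarrow> (real \<Rightarrow> complex) set" where
  "Dsp W s \<sigma> = {u \<in> Xsp \<sigma>. Lop W s u \<in> Ysp \<sigma>}"

definition Omega1 :: "real \<Rightarrow> complex set" where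
  "Omega1 \<sigma> = {s. Re s \<le> 0 \<and> \<sigma> < \<bar>Im s\<bar>} \<union> {s. Re s > 0 \<and> \<sigma> < cmod s}"

definition Omega2 :: "real \<Rightarrow> complex set" where
  "Omega2 \<sigma> = {s. \<sigma> < cmod s + Re s \<and> \<sigma> > - Re s * cmod s / (2 * (cmod s + Re s))}"

definition Omega3 :: "real \<Rightarrow> complex set" where
  "Omega3 \<sigma> = {s. s \<noteq> 0 \<and>
     \<sigma> * (cmod s - \<sigma> + Re s) - (\<sigma> * (1 + Re s / cmod s) + Re s / 2)^2 > 0}"

definition Omega :: "real \<Rightarrow> complex set" where
  "Omega \<sigma> = Omega1 \<sigma> \<inter> (Omega2 \<sigma> \<union> Omega3 \<sigma>)"

definition cdim :: "(real \<Rightarrow> complex) set \<Rightarrow> nat" where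
  "cdim V = vector_space.dim (\<lambda>c::complex. \<lambda>f::real \<Rightarrow> complex. \<lambda>x. c * f x) V"

end

theory Submission
  imports Defs
begin

text \<open>
  The two kernels coincide as sets.  Differentiating \<open>L\<^sub>s u = 0\<close> \<open>n\<close> times and rescaling
  \<open>A\<^sub>n = w\<^sub>n u\<^sup>(\<^sup>n\<^sup>)\<close>, where \<open>w\<^bsub>n+1\<^esub> = w\<^sub>n \<rho>\<^sub>n / (n (n + 1))\<close>, gives
  \<open>x\<^sup>2 A\<^bsub>n+1\<^esub>' + (2 (n + 1) x + s) A\<^bsub>n+1\<^esub> + \<rho>\<^sub>n A\<^sub>n = F\<^sub>n\<close>,
  where the contribution \<open>F\<^sub>n\<close> of the potential is of relative size \<open>1/n\<close>.
  Pairing with \<open>A\<^bsub>n+1\<^esub>\<close> and taking real parts controls the region where \<open>(2 n + 1) x + Re s > 0\<close>;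
  the boundary term at \<open>0\<close> is bounded by the recurrence at \<open>x = 0\<close>, because \<open>|s|\<close> exceeds the rates \<open>\<rho>\<^sub>n\<close>.
  For \<open>Re s \<le> 0\<close> the complementary region is controlled by the imaginary part, localised by a Lipschitz
  cutoff in \<open>z = (2 n + 1) x\<close> and summed over \<open>n\<close>; this requires \<open>|Im s| > |z\<^sup>2 / (4 R) - R|\<close> for
  \<open>0 \<le> z \<le> - Re s\<close>, which follows from \<open>s \<in> \<Omega>\<^sub>R\<close>.

  Only the tail of this sum needs a priori information on \<open>u\<close>.  Hence one may use the rate
  \<open>R + \<delta>\<close> up to index \<open>N\<close> and \<open>R - \<delta>\<close> afterwards: the resulting bound does not depend on \<open>N\<close>,
  so regularity just below \<open>R\<close> improves to regularity at \<open>R + \<delta>\<close>.  A supremum argument in \<open>R\<close>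
  carries a kernel element from \<open>\<sigma>\<close> past \<open>\<sigma>'\<close>.
\<close>

section \<open>Derivative families on the unit interval\<close>

text \<open>One-sided derivatives on a nondegenerate closed interval are unique, so agreement passes
  from each order to the next. Hence the choice made by \<open>SOME\<close> in \<open>dn\<close> is
  immaterial on [0,1].\<close>

lemma derivs_family_unique:
  assumes "derivs_family u D" "derivs_family v D'" "\<And>x. x \<in> {0..1} \<Longrightarrow> u x = v x"
    and "x \<in> {0..1}"
  shows "D n x = D' n x"
  using \<open>x \<in> {0..1}\<close>
proof (induction n arbitrary: x)
  case 0
  then show ?case using assms by (auto simp: derivs_family_def)
next
  case (Suc n)
  have 1: "(D n has_vector_derivative D (Suc n) x) (at x within {0..1})"
    using assms(1) Suc.prems by (auto simp: derivs_family_def)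
  have "(D' n has_vector_derivative D' (Suc n) x) (at x within {0..1})"
    using assms(2) Suc.prems by (auto simp: derivs_family_def)
  then have 2: "(D n has_vector_derivative D' (Suc n) x) (at x within {0..1})"
    by (rule has_vector_derivative_transform[rotated 2]) (use Suc in auto)
  show ?case
    using vector_derivative_unique_within_closed_interval[of 0 1 x "D n"] 1 2 Suc.prems by auto
qed

lemma derivs_family_dn: "smooth_I u \<Longrightarrow> derivs_family u (\<lambda>n. dn n u)"
  unfolding dn_def smooth_I_def by (metis someI_ex)

text \<open>The working tool for computing \<open>dn\<close>: it suffices to exhibit one complete
  family of derivatives.\<close>

lemma dn_eqI: "derivs_family u D \<Longrightarrow> x \<in> {0..1} \<Longrightarrow> dn n u x = D n x"
  by (metis derivs_family_dn derivs_family_unique smooth_I_def)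

lemma dn_zero: "x \<in> {0..1} \<Longrightarrow> dn n (\<lambda>x. 0) x = 0"
  by (rule dn_eqI[where D="\<lambda>n x. 0"]) (auto simp: derivs_family_def)

text \<open>For elements of the kernel this makes the condition
  \<open>Lop W s u \<in> Ysp \<sigma>\<close> automatic, so that membership in \<open>Dsp\<close>
  reduces to membership in \<open>Xsp\<close>.\<close>

lemma zero_in_Ysp: "(\<lambda>x. 0) \<in> Ysp \<sigma>"
proof -
  have "smooth_I (\<lambda>x. 0)"
    unfolding smooth_I_def derivs_family_def by (intro exI[of _ "\<lambda>n x. 0"]) auto
  moreover have "integral {0..1} (\<lambda>x. (x / \<sigma>) ^ k * (norm (dn n (\<lambda>x. 0) x))\<^sup>2) = 0" for k n
    using integral_cong[of "{0..1}" "\<lambda>x. (x / \<sigma>) ^ k * (norm (dn n (\<lambda>x. 0) x))\<^sup>2" "\<lambda>x. 0"]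
    by (simp add: dn_zero)
  then have "seminorm_term \<sigma> k (\<lambda>x. 0) = (\<lambda>n. 0)" for k
    by (auto simp: seminorm_term_def fun_eq_iff)
  moreover have "bdry_term \<sigma> (\<lambda>x. 0) = (\<lambda>n. 0)"
    by (auto simp: bdry_term_def fun_eq_iff dn_zero)
  ultimately show ?thesis
    by (simp add: Ysp_def Cinf_def seminorm_fin_def bdry_fin_def)
qed

lemma dn_dx:
  assumes "smooth_I u" "x \<in> {0..1}"
  shows "dn n (dx u) x = dn (Suc n) u x"
proof (rule dn_eqI)
  show "derivs_family (dx u) (\<lambda>n. dn (Suc n) u)"
    using derivs_family_dn[OF assms(1)] by (auto simp: derivs_family_def dx_def)
qed (use assms in auto)

text \<open>Leibniz rule, obtained by induction-free differentiation of the binomial sum and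
  Pascal's rule.\<close>

lemma derivs_family_mult:
  assumes "derivs_family f F" "derivs_family g G"
  shows "derivs_family (\<lambda>x. f x * g x) (\<lambda>n x. \<Sum>k\<le>n. of_nat (n choose k) * F k x * G (n - k) x)"
proof -
  have "((\<lambda>x. \<Sum>k\<le>n. of_nat (n choose k) * F k x * G (n - k) x) has_vector_derivative
      (\<Sum>k\<le>Suc n. of_nat (Suc n choose k) * F k x * G (Suc n - k) x)) (at x within {0..1})"
    if x: "x \<in> {0..1}" for n x
  proof -
    have F: "(F k has_vector_derivative F (Suc k) x) (at x within {0..1})"
      and G: "(G k has_vector_derivative G (Suc k) x) (at x within {0..1})" for k
      using assms x by (auto simp: derivs_family_def)
    have "((\<lambda>x. \<Sum>k\<le>n. of_nat (n choose k) * (F k x * G (n - k) x)) has_vector_derivative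
      (\<Sum>k\<le>n. of_nat (n choose k) * (F k x * G (Suc (n - k)) x + F (Suc k) x * G (n - k) x))) (at x within {0..1})"
      by (intro has_vector_derivative_sum has_vector_derivative_mult_right has_vector_derivative_mult F G)
    also have "(\<Sum>k\<le>n. of_nat (n choose k) * (F k x * G (Suc (n - k)) x + F (Suc k) x * G (n - k) x)) =
       (\<Sum>k\<le>Suc n. of_nat (Suc n choose k) * F k x * G (Suc n - k) x)"
    proof -
      \<comment> \<open>The added summand k = n + 1 vanishes because \<open>n choose Suc n\<close>
        is 0; both sums then start with a separate k = 0 term and can be merged by Pascal's
        rule.\<close>
      have 1: "(\<Sum>k\<le>n. of_nat (n choose k) * (F k x * G (Suc (n - k)) x)) =
         (\<Sum>k\<le>Suc n. of_nat (n choose k) * (F k x * G (Suc n - k) x))"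
        by (simp add: Suc_diff_le)
      have 2: "\<dots> = F 0 x * G (Suc n) x + (\<Sum>k\<le>n. of_nat (n choose Suc k) * (F (Suc k) x * G (n - k) x))"
        by (subst sum.atMost_Suc_shift) simp
      show ?thesis
        unfolding sum.atMost_Suc_shift[of _ n] distrib_left sum.distrib 1 2
        by (simp add: algebra_simps sum.distrib)
    qed
    finally show ?thesis by (simp add: mult.assoc)
  qed
  then show ?thesis using assms by (auto simp: derivs_family_def)
qed

text \<open>The differentiated operator keeps its shape: differentiating x^2 adds 2x to the middle
  coefficient, and n(n+1) + 2(n+1) = (n+1)(n+2).\<close>

lemma singular_derivs_step:
  fixes U :: "nat \<Rightarrow> real \<Rightarrow> complex"
  assumes "\<And>n. (U n has_vector_derivative U (Suc n) x) (at x within S)"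
  shows "((\<lambda>x. of_real (x\<^sup>2) * U (n+2) x + (of_real (2 * real (n+1) * x) + s) * U (n+1) x
              + of_nat (n * (n+1)) * U n x)
     has_vector_derivative (of_real (x\<^sup>2) * U (Suc n+2) x + (of_real (2 * real (Suc n+1) * x) + s) * U (Suc n+1) x
              + of_nat (Suc n * (Suc n+1)) * U (Suc n) x)) (at x within S)"
proof -
  have a: "((\<lambda>x. complex_of_real (x\<^sup>2)) has_vector_derivative of_real (2 * x)) (at x within S)"
    by (intro has_vector_derivative_of_real) (auto intro!: derivative_eq_intros)
  have b: "((\<lambda>x. complex_of_real (2 * real (n+1) * x) + s) has_vector_derivative of_real (2 * real (n+1))) (at x within S)"
    unfolding has_vector_derivative_add_const
    by (intro has_vector_derivative_of_real) (auto intro!: derivative_eq_intros)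
  show ?thesis
    by (rule has_vector_derivative_eq_rhs[OF has_vector_derivative_add[OF has_vector_derivative_add[OF
          has_vector_derivative_mult[OF a assms] has_vector_derivative_mult[OF b assms]]
          has_vector_derivative_mult_right[OF assms]]])
       (simp add: algebra_simps)
qed

lemma dn_square_mult_dn:
  assumes "smooth_I u" "x \<in> {0..1}"
  shows "dn 1 (\<lambda>y. complex_of_real (y^2) * dn 1 u y) x = of_real (x^2) * dn 2 u x + of_real (2 * x) * dn 1 u x"
proof -
  let ?U = "\<lambda>n. dn n u"
  \<comment> \<open>Identifying \<open>dn 1\<close> requires the whole derivative family of x^2 u'.
    From order 1 on it is the previous pattern with s = 0, hence the index shift by one.\<close>
  define D where "D n x = (case n of 0 \<Rightarrow> complex_of_real (x^2) * dn 1 u x |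
     Suc n \<Rightarrow> of_real (x\<^sup>2) * ?U (n+2) x + (of_real (2 * real (n+1) * x) + 0) * ?U (n+1) x
              + of_nat (n * (n+1)) * ?U n x)" for n x
  have d: "(?U n has_vector_derivative ?U (Suc n) x) (at x within {0..1})" if "x \<in> {0..1}" for n x
    using derivs_family_dn[OF assms(1)] that by (auto simp: derivs_family_def)
  have a: "((\<lambda>x. complex_of_real (x\<^sup>2)) has_vector_derivative of_real (2 * x)) (at x within S)" for x S
    by (intro has_vector_derivative_of_real) (auto intro!: derivative_eq_intros)
  have "derivs_family (\<lambda>y. complex_of_real (y^2) * dn 1 u y) D"
    unfolding derivs_family_def
  proof (intro conjI ballI allI)
    fix n and x :: real assume x: "x \<in> {0..1}"
    show "(D n has_vector_derivative D (Suc n) x) (at x within {0..1})"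
    proof (cases n)
      case 0
      have "((\<lambda>x. of_real (x^2) * dn 1 u x) has_vector_derivative
          of_real (x^2) * dn (Suc 1) u x + of_real (2 * x) * dn 1 u x) (at x within {0..1})"
        by (intro has_vector_derivative_mult a d x)
      then show ?thesis by (simp add: 0 D_def[abs_def] numeral_2_eq_2)
    next
      case (Suc m)
      show ?thesis unfolding Suc D_def[abs_def] nat.case
        by (rule singular_derivs_step) (rule d[OF x])
    qed
  qed (simp add: D_def)
  from dn_eqI[OF this assms(2), of 1] show ?thesis
    by (simp add: D_def numeral_2_eq_2)
qed

text \<open>Both sides are derivative families of the product W u, so uniqueness identifies them at
  every order.\<close>

lemma kernel_ode:
  assumes "smooth_I u" "smooth_I W" "Lop W s u = (\<lambda>x. 0)" "x \<in> {0..1}"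
  shows "of_real (x\<^sup>2) * dn (n+2) u x + (of_real (2 * real (n+1) * x) + s) * dn (n+1) u x
              + of_nat (n * (n+1)) * dn n u x = (\<Sum>k\<le>n. of_nat (n choose k) * dn k W x * dn (n - k) u x)"
proof -
  let ?U = "\<lambda>n. dn n u"
  let ?D = "\<lambda>n x. of_real (x\<^sup>2) * ?U (n+2) x + (of_real (2 * real (n+1) * x) + s) * ?U (n+1) x
              + of_nat (n * (n+1)) * ?U n x"
  have d: "(?U n has_vector_derivative ?U (Suc n) x) (at x within {0..1})" if "x \<in> {0..1}" for n x
    using derivs_family_dn[OF assms(1)] that by (auto simp: derivs_family_def)
  have "derivs_family (?D 0) ?D"
    unfolding derivs_family_def by (intro conjI ballI allI refl singular_derivs_step d)
  moreover have "derivs_family (\<lambda>x. W x * u x) (\<lambda>n x. \<Sum>k\<le>n. of_nat (n choose k) * dn k W x * dn (n - k) u x)"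
    by (intro derivs_family_mult derivs_family_dn assms)
  moreover have "?D 0 x = W x * u x" if "x \<in> {0..1}" for x
    using fun_cong[OF assms(3), of x] that dn_square_mult_dn[OF assms(1) that]
    by (simp add: Lop_def algebra_simps numeral_2_eq_2)
  ultimately show ?thesis using assms(4) by (rule derivs_family_unique)
qed

section \<open>Weights and the rescaled equation\<close>

text \<open>For a constant rate r the weight at n + 1 is r^n / (n! (n+1)!), whose square is the
  weight of the n-th term in the norms of u'. Variable rates allow the rate to be switched at a
  chosen index. Index 0 is set apart because the recurrence divides by n(n+1).\<close>

definition wt :: "(nat \<Rightarrow> real) \<Rightarrow> nat \<Rightarrow> real" where
  "wt \<rho> n = (if n = 0 then 1 else (\<Prod>i\<in>{1..<n}. \<rho> i) / (fact (n - 1) * fact n))"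

lemma wt_0 [simp]: "wt \<rho> 0 = 1"
  by (simp add: wt_def)

lemma wt_Suc:
  assumes "n \<ge> 1"
  shows "wt \<rho> (Suc n) = wt \<rho> n * \<rho> n / (real n * real (n + 1))"
proof -
  obtain m where n: "n = Suc m" using assms by (cases n) auto
  have "prod \<rho> {1..<Suc n} = prod \<rho> {1..<n} * \<rho> n" using assms by simp
  then show ?thesis
    by (simp add: wt_def n field_simps del: prod.op_ivl_Suc)
qed

lemma wt_nonneg: "(\<And>i. \<rho> i \<ge> 0) \<Longrightarrow> wt \<rho> n \<ge> 0"
  by (auto simp: wt_def intro!: divide_nonneg_nonneg prod_nonneg)

lemma wt_mono: "(\<And>i. 0 \<le> \<rho> i \<and> \<rho> i \<le> \<rho>' i) \<Longrightarrow> wt \<rho> n \<le> wt \<rho>' n"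
  by (auto simp: wt_def intro!: divide_right_mono prod_mono)

lemma wt_const: "wt (\<lambda>_. r) (Suc n) = r ^ n / (fact n * fact (Suc n))"
  by (simp add: wt_def)

lemma fact_mult_le: "fact a * fact b \<le> (fact (a + b) :: real)"
proof -
  have "fact a * fact b dvd (fact (a + b) :: nat)" by (rule fact_fact_dvd_fact)
  then have "fact a * fact b \<le> (fact (a + b) :: nat)" by (rule dvd_imp_le) simp
  then show ?thesis by (metis of_nat_fact of_nat_le_iff of_nat_mult)
qed

text \<open>The gap R < S lets the Gevrey decay of the potential dominate the weights, and the
  remaining quotient of factorials leaves a factor 1/(n(n+1)). This is what makes the potential a
  lower order perturbation.\<close>

lemma wt_conv_bound:
  fixes w :: "nat \<Rightarrow> real"
  assumes \<rho>: "\<And>i. 0 \<le> \<rho> i \<and> \<rho> i \<le> R" and R: "0 < R" "R < S"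
    and w: "\<And>k. 0 \<le> w k \<and> w k \<le> C * (fact k)\<^sup>2 / S ^ k"
    and D: "C * R \<le> D" "\<And>n. C * (real n * (R / S) ^ n) \<le> D"
    and n: "n \<ge> 1" "k \<le> n"
  shows "wt \<rho> (Suc n) * real (n choose k) * w k \<le> D / (real n * real (n + 1)) * wt \<rho> (n - k)"
proof -
  have S: "S > 0" using R by simp
  have C: "C \<ge> 0" using w[of 0] by simp
  have w0: "wt \<rho> m \<ge> 0" for m using \<rho> by (intro wt_nonneg) auto
  obtain n' where n': "n = Suc n'" using n by (cases n) auto
  have "wt \<rho> (Suc n) * real (n choose k) * w k \<le> wt \<rho> (Suc n) * real (n choose k) * (C * (fact k)\<^sup>2 / S ^ k)"
    using w w0 by (intro mult_left_mono) auto
  also have "\<dots> \<le> D / (real n * real (n + 1)) * wt \<rho> (n - k)"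
  \<comment> \<open>For k = n the weight on the right is \<open>wt \<rho> 0\<close>, which is
    outside the product formula; what remains is n (R/S)^n. For k < n one is left with (R/S)^k k! m!
    / (m+k)!, which is at most 1.\<close>
  proof (cases "k = n")
    case True
    have "prod \<rho> {1..<Suc n} \<le> prod (\<lambda>_. R) {1..<Suc n}" using \<rho> by (intro prod_mono) auto
    then have p: "prod \<rho> {1..<Suc n} \<le> R ^ n" by simp
    have "wt \<rho> (Suc n) * real (n choose k) * (C * (fact k)\<^sup>2 / S ^ k) =
         prod \<rho> {1..<Suc n} * (C / S ^ n / (real n + 1))"
      using S by (simp add: True wt_def power2_eq_square divide_simps del: prod.op_ivl_Suc)
    also have "\<dots> \<le> R ^ n * (C / S ^ n / (real n + 1))"
      using p C S by (intro mult_right_mono) auto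
    also have "\<dots> = C * (real n * (R / S) ^ n) / (real n * real (n + 1))"
      using n S by (simp add: power_divide add.commute mult.commute)
    also have "\<dots> \<le> D / (real n * real (n + 1))" using D by (intro divide_right_mono) auto
    finally show ?thesis using True by simp
  next
    case False
    define m where "m = n - k - 1"
    have nm: "n = Suc (m + k)" using False n by (simp add: m_def)
    have "{1..<Suc n} = {1..<Suc m} \<union> {Suc m..<Suc n}" using nm by auto
    then have "prod \<rho> {1..<Suc n} = prod \<rho> {1..<Suc m} * prod \<rho> {Suc m..<Suc n}"
      by (simp add: prod.union_disjoint del: prod.op_ivl_Suc)
    also have "prod \<rho> {Suc m..<Suc n} \<le> prod (\<lambda>_. R) {Suc m..<Suc n}"
      using \<rho> by (intro prod_mono) auto
    finally have p: "prod \<rho> {1..<Suc n} \<le> prod \<rho> {1..<Suc m} * R ^ Suc k"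
      using \<rho> by (simp add: mult_left_mono prod_nonneg nm del: prod.op_ivl_Suc)
    have f: "fact k * fact m / fact (m + k) \<le> (1::real)"
      using fact_mult_le[of k m] by (simp add: add.commute)
    have rs: "(R / S) ^ k \<le> 1" using R by (intro power_le_one) auto
    have b: "real (n choose k) = fact n / (fact k * fact (Suc m))"
      using binomial_fact[of k n, where 'a=real] nm by simp
    have "wt \<rho> (Suc n) * real (n choose k) * (C * (fact k)\<^sup>2 / S ^ k) =
       prod \<rho> {1..<Suc n} * (C * fact k / (S ^ k * fact (Suc m) * fact (Suc n)))"
      by (simp add: b wt_def power2_eq_square del: prod.op_ivl_Suc fact_Suc)
    also have "\<dots> \<le> (prod \<rho> {1..<Suc m} * R ^ Suc k) * (C * fact k / (S ^ k * fact (Suc m) * fact (Suc n)))"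
      using p C S by (intro mult_right_mono) auto
    also have "\<dots> = (C * R * (R / S) ^ k * (fact k * fact m / fact (m + k))) / (real n * real (n + 1)) * wt \<rho> (Suc m)"
    proof -
      have fn: "fact (Suc n) = real n * real (n + 1) * fact (m + k)"
        by (simp add: nm algebra_simps)
      show ?thesis unfolding fn using S
        by (simp add: wt_def power_divide divide_simps del: prod.op_ivl_Suc fact_Suc of_nat_add)
    qed
    also have "\<dots> \<le> D / (real n * real (n + 1)) * wt \<rho> (Suc m)"
    proof -
      have "C * R * (R / S) ^ k * (fact k * fact m / fact (m + k)) \<le> C * R * 1 * 1"
        using C R rs f by (intro mult_mono) auto
      then show ?thesis using D w0 by (intro mult_right_mono divide_right_mono) auto
    qed
    finally show ?thesis by (simp add: nm)
  qed
  finally show ?thesis .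
qed

section \<open>The rescaled differentiated equation and its bounds\<close>

lemma times_power_bounded:
  fixes q :: real
  assumes "0 \<le> q" "q < 1"
  shows "\<exists>B. \<forall>n. real n * q ^ n \<le> B"
proof -
  have "(\<lambda>n. real n * q ^ n) \<longlonglongrightarrow> 0" using assms by (intro powser_times_n_limit_0) auto
  then have "Bseq (\<lambda>n. real n * q ^ n)" using convergentI convergent_imp_Bseq by blast
  then show ?thesis unfolding Bseq_def by (metis abs_le_D1 real_norm_def)
qed

text \<open>The setting retains only the differentiated equations and a Gevrey bound of order 2 with
  rate S for the potential; \<open>U n\<close> and \<open>Wd n\<close> stand for the n-th
  derivatives of u and W.\<close>

locale singular_ode =
  fixes U Wd :: "nat \<Rightarrow> real \<Rightarrow> complex" and s :: complex and S C :: real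
  assumes U_deriv: "\<And>n x. x \<in> {0..1} \<Longrightarrow> (U n has_vector_derivative U (Suc n) x) (at x within {0..1})"
    and W_bound: "\<And>n x. x \<in> {0..1} \<Longrightarrow> cmod (Wd n x) \<le> C * (fact n)\<^sup>2 / S ^ n"
    and ode: "\<And>n x. x \<in> {0..1} \<Longrightarrow> of_real (x\<^sup>2) * U (n+2) x + (of_real (2 * real (n+1) * x) + s) * U (n+1) x
              + of_nat (n * (n+1)) * U n x = (\<Sum>k\<le>n. of_nat (n choose k) * Wd k x * U (n - k) x)"
begin

definition A :: "(nat \<Rightarrow> real) \<Rightarrow> nat \<Rightarrow> real \<Rightarrow> complex" where
  "A \<rho> n x = of_real (wt \<rho> n) * U n x"

definition F :: "(nat \<Rightarrow> real) \<Rightarrow> nat \<Rightarrow> real \<Rightarrow> complex" where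
  "F \<rho> n x = of_real (wt \<rho> (Suc n)) * (\<Sum>k\<le>n. of_nat (n choose k) * Wd k x * U (n - k) x)"

definition energy :: "(nat \<Rightarrow> real) \<Rightarrow> nat \<Rightarrow> real" where
  "energy \<rho> n = integral {0..1} (\<lambda>x. (cmod (A \<rho> n x))\<^sup>2)"

lemma A_cont [continuous_intros]: "continuous_on {0..1} (A \<rho> n)"
proof -
  have "continuous_on {0..1} (U n)"
    by (rule continuous_on_vector_derivative[OF U_deriv])
  then show ?thesis unfolding A_def[abs_def] by (intro continuous_intros)
qed

lemma A_deriv:
  assumes "x \<in> {0..1}" "n \<ge> 1" "\<rho> n \<noteq> 0"
  shows "(A \<rho> n has_vector_derivative of_real (real n * real (n + 1) / \<rho> n) * A \<rho> (Suc n) x) (at x within {0..1})"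
proof -
  have "(A \<rho> n has_vector_derivative of_real (wt \<rho> n) * U (Suc n) x) (at x within {0..1})"
    unfolding A_def[abs_def] by (intro has_vector_derivative_mult_right U_deriv assms)
  moreover have "of_real (wt \<rho> n) * U (Suc n) x = of_real (real n * real (n + 1) / \<rho> n) * A \<rho> (Suc n) x"
  proof -
    have "wt \<rho> n = real n * real (n + 1) / \<rho> n * wt \<rho> (Suc n)"
      using assms by (simp add: wt_Suc)
    then show ?thesis by (simp add: A_def mult.assoc)
  qed
  ultimately show ?thesis by simp
qed

text \<open>The weight recurrence turns n(n+1) U_n into \<open>\<rho> n * A \<rho> n\<close>; used
  once more at n + 1, it expresses the leading term through \<open>A \<rho> (n+2)\<close>.\<close>

lemma A_ode:
  assumes "x \<in> {0..1}" "n \<ge> 1" "\<rho> (n+1) \<noteq> 0"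
  shows "of_real (x\<^sup>2 * real (n + 1) * real (n + 2) / \<rho> (n + 1)) * A \<rho> (n+2) x +
     (of_real (2 * real (n+1) * x) + s) * A \<rho> (n+1) x + of_real (\<rho> n) * A \<rho> n x = F \<rho> n x"
proof -
  have 1: "wt \<rho> (n+2) = wt \<rho> (n+1) * \<rho> (n+1) / (real (n+1) * real (n+2))"
    using wt_Suc[of "n+1" \<rho>] by (simp add: numeral_2_eq_2)
  have 2: "wt \<rho> n * \<rho> n = wt \<rho> (n+1) * real (n * (n + 1))"
    using assms(2) by (simp add: wt_Suc[OF assms(2)] nonzero_divide_eq_eq divide_simps) (simp add: algebra_simps)
  have "F \<rho> n x = of_real (wt \<rho> (n+1)) * (of_real (x\<^sup>2) * U (n+2) x + (of_real (2 * real (n+1) * x) + s) * U (n+1) x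
              + of_nat (n * (n+1)) * U n x)"
    using ode[OF assms(1), of n] by (simp add: F_def)
  also have "\<dots> = of_real (x\<^sup>2 * wt \<rho> (n+1)) * U (n+2) x + (of_real (2 * real (n+1) * x) + s) * A \<rho> (n+1) x
              + of_real (wt \<rho> (n+1) * real (n * (n+1))) * U n x"
    unfolding A_def of_real_mult of_real_of_nat_eq by (simp only: algebra_simps)
  also have "x\<^sup>2 * wt \<rho> (n+1) = x\<^sup>2 * real (n + 1) * real (n + 2) / \<rho> (n + 1) * wt \<rho> (n+2)"
    using assms(3) unfolding 1 by simp
  finally show ?thesis
    unfolding 2[symmetric] by (simp add: A_def mult.assoc mult.commute mult.left_commute)
qed

text \<open>Continuity is read off from the left side of the equation, since the locale says nothing
  on the continuity of \<open>Wd\<close>.\<close>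

lemma F_cont [continuous_intros]:
  assumes "n \<ge> 1" "\<rho> (n+1) \<noteq> 0"
  shows "continuous_on {0..1} (F \<rho> n)"
proof -
  have "continuous_on {0..1} (\<lambda>x. of_real (x\<^sup>2 * real (n + 1) * real (n + 2) / \<rho> (n + 1)) * A \<rho> (n+2) x +
     (of_real (2 * real (n+1) * x) + s) * A \<rho> (n+1) x + of_real (\<rho> n) * A \<rho> n x)"
    using assms by (intro continuous_intros) auto
  then show ?thesis by (rule continuous_on_eq) (use A_ode[of _ n \<rho>] assms in blast)
qed

text \<open>The constant D is uniform over all rate sequences with values in [0,R]. This matters
  because the rates used later depend on a switching index.\<close>

lemma F_bound:
  assumes R: "0 < R" "R < S"
  obtains D where "D \<ge> 0" and "\<And>\<rho> n x. (\<And>i. 0 \<le> \<rho> i \<and> \<rho> i \<le> R) \<Longrightarrow> n \<ge> 1 \<Longrightarrow> x \<in> {0..1} \<Longrightarrow>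
     cmod (F \<rho> n x) \<le> D / (real n * real (n + 1)) * (\<Sum>m\<le>n. cmod (A \<rho> m x))"
proof -
  have C: "C \<ge> 0" using W_bound[of 0 0] order_trans[OF norm_ge_zero, of "Wd 0 0"] by simp
  obtain B where B: "\<And>n. real n * (R / S) ^ n \<le> B"
    using times_power_bounded[of "R / S"] R by auto
  define D where "D = max (C * R) (C * B)"
  have D: "C * R \<le> D" "\<And>n. C * (real n * (R / S) ^ n) \<le> D"
    unfolding D_def using C B by (auto simp: le_max_iff_disj intro!: mult_left_mono)
  have D0: "D \<ge> 0" using D(2)[of 0] by simp
  show thesis
  proof (rule that[OF D0])
    fix \<rho> :: "nat \<Rightarrow> real" and n :: nat and x :: real
    assume \<rho>: "\<And>i. 0 \<le> \<rho> i \<and> \<rho> i \<le> R" and n: "n \<ge> 1" and x: "x \<in> {0..1}"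
    have w0: "wt \<rho> m \<ge> 0" for m using \<rho> by (intro wt_nonneg) auto
    have "cmod (F \<rho> n x) = wt \<rho> (Suc n) * cmod (\<Sum>k\<le>n. of_nat (n choose k) * Wd k x * U (n - k) x)"
      using w0 by (simp add: F_def norm_mult)
    also have "\<dots> \<le> wt \<rho> (Suc n) * (\<Sum>k\<le>n. cmod (of_nat (n choose k) * Wd k x * U (n - k) x))"
      by (intro mult_left_mono norm_sum w0)
    also have "\<dots> = (\<Sum>k\<le>n. wt \<rho> (Suc n) * real (n choose k) * cmod (Wd k x) * cmod (U (n - k) x))"
      by (simp add: sum_distrib_left norm_mult mult.assoc)
    also have "\<dots> \<le> (\<Sum>k\<le>n. D / (real n * real (n + 1)) * wt \<rho> (n - k) * cmod (U (n - k) x))"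
    proof (intro sum_mono mult_right_mono)
      fix k assume "k \<in> {..n}"
      then show "wt \<rho> (Suc n) * real (n choose k) * cmod (Wd k x) \<le> D / (real n * real (n + 1)) * wt \<rho> (n - k)"
        using W_bound[OF x] by (intro wt_conv_bound[OF \<rho> R _ D n]) auto
    qed auto
    also have "\<dots> = D / (real n * real (n + 1)) * (\<Sum>k\<le>n. cmod (A \<rho> (n - k) x))"
      using w0 by (simp add: A_def norm_mult sum_distrib_left mult.assoc)
    also have "(\<Sum>k\<le>n. cmod (A \<rho> (n - k) x)) = (\<Sum>m\<le>n. cmod (A \<rho> m x))"
      by (rule sum.reindex_bij_witness[of _ "\<lambda>m. n - m" "\<lambda>m. n - m"]) auto
    finally show "cmod (F \<rho> n x) \<le> D / (real n * real (n + 1)) * (\<Sum>m\<le>n. cmod (A \<rho> m x))" .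
  qed
qed

text \<open>At x = 0 the equation degenerates to s A_{n+1} + R A_n = F_n. As R < |s|, the recurrence
  contracts, and for large n the gap |s| - R absorbs F_n.\<close>

lemma A_at_0_bounded:
  assumes R: "0 < R" "R < S" "R < cmod s"
  obtains B where "\<And>n. cmod (A (\<lambda>_. R) n 0) \<le> B"
proof -
  define a where "a n = cmod (A (\<lambda>_. R) n 0)" for n
  obtain D where D: "D \<ge> 0" and F: "\<And>n. n \<ge> 1 \<Longrightarrow>
     cmod (F (\<lambda>_. R) n 0) \<le> D / (real n * real (n + 1)) * (\<Sum>m\<le>n. a m)"
    using F_bound[OF R(1,2)] R unfolding a_def
    by (metis atLeastAtMost_iff less_eq_real_def order_refl zero_le_one)
  \<comment> \<open>From \<open>n1\<close> on, the n + 1 summands in the bound of F_n cost at most D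
    / n times the running bound, which fits into the gap |s| - R.\<close>
  obtain n1 :: nat where n1: "n1 \<ge> 1" "D / real n1 \<le> cmod s - R"
  proof -
    obtain n :: nat where "real n > D / (cmod s - R)" using reals_Archimedean2 by blast
    then have "D / real (Suc n) \<le> cmod s - R" using R by (simp add: field_simps)
    then show thesis using that[of "Suc n"] by auto
  qed
  define B where "B = (\<Sum>m\<le>n1. a m)"
  have a0: "a m \<ge> 0" for m by (simp add: a_def)
  have B0: "B \<ge> 0" unfolding B_def by (intro sum_nonneg a0)
  have "a n \<le> B" for n
  proof (induction n rule: less_induct)
    case (less n)
    show ?case
    proof (cases "n \<le> n1")
      case True
      then show ?thesis unfolding B_def by (intro member_le_sum) (auto simp: a0)
    next
      case False
      then obtain m where m: "n = Suc m" "m \<ge> n1" by (cases n) auto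
      have m1: "m \<ge> 1" using m n1 by simp
      have "s * A (\<lambda>_. R) (m+1) 0 = F (\<lambda>_. R) m 0 - of_real R * A (\<lambda>_. R) m 0"
        using A_ode[of 0 m "\<lambda>_. R"] R m1 by (simp add: algebra_simps)
      then have "cmod s * a n \<le> cmod (F (\<lambda>_. R) m 0) + R * a m"
        using R norm_triangle_ineq4[of "F (\<lambda>_. R) m 0" "of_real R * A (\<lambda>_. R) m 0"]
        by (metis Suc_eq_plus1 a_def m(1) norm_mult norm_of_real abs_of_pos)
      also have "\<dots> \<le> D / (real m * real (m + 1)) * (\<Sum>i\<le>m. a i) + R * B"
        using F[OF m1] less.IH[of m] m R by (intro add_mono mult_left_mono) auto
      also have "(\<Sum>i\<le>m. a i) \<le> (\<Sum>i\<le>m. B)"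
        using less.IH m by (intro sum_mono) auto
      finally have 1: "cmod s * a n \<le> D / (real m * real (m + 1)) * (\<Sum>i\<le>m. B) + R * B"
        using D by (simp add: mult_left_mono divide_right_mono)
      have "D / real m \<le> D / real n1"
        using D n1 m by (intro divide_left_mono) auto
      then have "D / real m * B \<le> (cmod s - R) * B" using n1 B0 by (intro mult_right_mono) auto
      moreover have "D / (real m * real (m + 1)) * (\<Sum>i\<le>m. B) = D / real m * B" using m1 by simp
      ultimately have "cmod s * a n \<le> cmod s * B" using 1 by (simp add: algebra_simps)
      then show ?thesis using R by (intro mult_left_le_imp_le[of "cmod s" "a n" B]) auto
    qed
  qed
  then show thesis using that a_def by metis
qed

end

section \<open>Cutoff defects and telescoping over the order of differentiation\<close>

text \<open>Here c is the defect left at index n when the localised fluxes are summed over n. With z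
  = (2n-1)x one has x^2 n(n+1) close to z^2/4, so c is close to q(z) (z^2/(4R) - R). The bound is
  given at two neighbouring values of z because the telescoping argument charges c to two
  neighbouring energies.\<close>

lemma cutoff_coeff_bound:
  fixes q :: "real \<Rightarrow> real" and R M L Z :: real
  defines "h \<equiv> \<lambda>z. q z * \<bar>z\<^sup>2 / (4 * R) - R\<bar>"
  assumes R: "R > 0" and q: "\<And>z. 0 \<le> q z \<and> q z \<le> M" and L: "\<And>z z'. \<bar>q z - q z'\<bar> \<le> L * \<bar>z - z'\<bar>"
    and Z: "Z \<ge> 0" "\<And>z. z \<ge> Z \<Longrightarrow> q z = 0"
  obtains K where "K \<ge> 0" and "\<And>n x r c. n \<ge> 1 \<Longrightarrow> x \<in> {0..1} \<Longrightarrow> \<bar>r - R\<bar> \<le> R / 2 \<Longrightarrow>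
      c = q ((2 * real n - 1) * x) * (x\<^sup>2 * real n * (real n + 1) / r) - q ((2 * real n + 1) * x) * r \<Longrightarrow>
      \<bar>c\<bar> \<le> h ((2 * real n - 1) * x) + K * (\<bar>r - R\<bar> + 1 / real n) \<and>
      \<bar>c\<bar> \<le> h ((2 * real n + 1) * x) + K * (\<bar>r - R\<bar> + 1 / real n)"
proof -
  \<comment> \<open>\<open>K1\<close> collects the errors proportional to |r - R|; \<open>K2\<close>
    and \<open>K3\<close> collect those proportional to x, which is at most Z / n where the cutoff
    is active.\<close>
  define K1 where "K1 = M * Z\<^sup>2 / (2 * R\<^sup>2) + M"
  define K2 where "K2 = M * (4 * Z + 3) / (2 * R) + 3 * L * R"
  define K3 where "K3 = 2 * L * (Z\<^sup>2 / (4 * R) + R) + M * Z / R"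
  define K where "K = K1 + (K2 + K3) * Z"
  have M: "M \<ge> 0" using q[of 0] by simp
  have L0: "L \<ge> 0" using L[of 0 1] by (simp add: order_trans[OF abs_ge_zero])
  have K0: "K1 \<ge> 0" "K2 \<ge> 0" "K3 \<ge> 0"
    using M L0 R Z by (auto simp: K1_def K2_def K3_def)
  have h0: "h z \<ge> 0" for z using q by (simp add: h_def)
  have "K \<ge> 0" unfolding K_def using K0 Z by simp
  then show thesis
  proof (rule that)
    fix n :: nat and x r c :: real
    assume n: "n \<ge> 1" and x: "x \<in> {0..1}" and r: "\<bar>r - R\<bar> \<le> R / 2"
      and c: "c = q ((2 * real n - 1) * x) * (x\<^sup>2 * real n * (real n + 1) / r) - q ((2 * real n + 1) * x) * r"
    define z where "z = (2 * real n - 1) * x"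
    define z' where "z' = (2 * real n + 1) * x"
    have zz: "z' = z + 2 * x" by (simp add: z_def z'_def algebra_simps)
    have z0: "z \<ge> 0" using n x by (simp add: z_def)
    have r': "r \<ge> R / 2" "r \<le> 3 * R / 2" using r unfolding abs_le_iff by linarith+
    have rp: "r > 0" using r' R by linarith
    have "\<bar>c\<bar> \<le> h z + K * (\<bar>r - R\<bar> + 1 / real n) \<and> \<bar>c\<bar> \<le> h z' + K * (\<bar>r - R\<bar> + 1 / real n)"
    proof (cases "z \<ge> Z")
      case True
      then have "c = 0" using Z x zz by (simp add: c z_def[symmetric] z'_def[symmetric])
      then show ?thesis using h0 \<open>K \<ge> 0\<close> by simp
    next
      case False
      then have zZ: "z \<le> Z" by simp
      \<comment> \<open>Where z < Z, the point x is of order 1/n; this converts every error carrying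
        a factor x into O(1/n).\<close>
      have xn: "x \<le> Z * (1 / real n)"
      proof -
        have "real n * x \<le> z" using n x by (auto simp: z_def intro!: mult_right_mono)
        then show ?thesis using zZ n by (simp add: field_simps)
      qed
      have x2: "x\<^sup>2 \<le> x" using x by (simp add: power2_eq_square mult_left_le)
      have nn: "x\<^sup>2 * real n * (real n + 1) = (z\<^sup>2 + 4 * z * x + 3 * x\<^sup>2) / 4"
        by (simp add: z_def power2_eq_square algebra_simps)
      have ir: "1 / r \<le> 2 / R" using r' R rp by (simp add: field_simps)
      \<comment> \<open>Four sources of error: r in place of R in the quotient, the lower order part
        of x^2 n(n+1), the shift of the cutoff from z to z', and r in place of R in the second
        term.\<close>
      have e: "c - q z * (z\<^sup>2 / (4 * R) - R) =
          q z * (z\<^sup>2 / 4) * ((R - r) / (r * R)) + q z * ((4 * z * x + 3 * x\<^sup>2) / 4) * (1 / r) + (q z - q z') * r + q z * (R - r)"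
        using rp R unfolding c nn z_def[symmetric] z'_def[symmetric] by (simp add: field_simps)
      have t1: "\<bar>q z * (z\<^sup>2 / 4) * ((R - r) / (r * R))\<bar> \<le> M * (Z\<^sup>2 / 4) * (2 / R\<^sup>2 * \<bar>r - R\<bar>)"
      proof -
        have "\<bar>(R - r) / (r * R)\<bar> = \<bar>r - R\<bar> / R * (1 / r)" using rp R
          by (simp add: abs_mult abs_minus_commute mult.commute)
        also have "\<dots> \<le> \<bar>r - R\<bar> / R * (2 / R)" using ir R by (intro mult_left_mono) auto
        finally have "\<bar>(R - r) / (r * R)\<bar> \<le> 2 / R\<^sup>2 * \<bar>r - R\<bar>" by (simp add: power2_eq_square mult.commute)
        moreover have "\<bar>q z * (z\<^sup>2 / 4)\<bar> \<le> M * (Z\<^sup>2 / 4)"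
          using q[of z] z0 zZ M by (auto simp: abs_mult intro!: mult_mono power_mono divide_right_mono)
        ultimately show ?thesis unfolding abs_mult[of "q z * (z\<^sup>2 / 4)"]
          using M by (intro mult_mono) auto
      qed
      have t2: "\<bar>q z * ((4 * z * x + 3 * x\<^sup>2) / 4) * (1 / r)\<bar> \<le> M * ((4 * Z + 3) * x / 4) * (2 / R)"
      proof -
        have "4 * z * x \<le> 4 * Z * x" using zZ x by (intro mult_right_mono) auto
        then have "4 * z * x + 3 * x\<^sup>2 \<le> (4 * Z + 3) * x" using x2 by (simp add: algebra_simps)
        then have "q z * ((4 * z * x + 3 * x\<^sup>2) / 4) * (1 / r) \<le> M * ((4 * Z + 3) * x / 4) * (2 / R)"
          using q[of z] z0 x M Z ir rp by (intro mult_mono) auto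
        moreover have "q z * ((4 * z * x + 3 * x\<^sup>2) / 4) * (1 / r) \<ge> 0"
          using q[of z] z0 x rp by simp
        ultimately show ?thesis by simp
      qed
      have t3: "\<bar>(q z - q z') * r\<bar> \<le> 2 * L * x * (3 * R / 2)"
      proof -
        have "\<bar>q z - q z'\<bar> \<le> 2 * L * x" using L[of z z'] x by (simp add: zz algebra_simps)
        then show ?thesis unfolding abs_mult using r' rp L0 x by (intro mult_mono) auto
      qed
      have t4: "\<bar>q z * (R - r)\<bar> \<le> M * \<bar>r - R\<bar>"
        unfolding abs_mult using q[of z] by (intro mult_mono) auto
      have "\<bar>c - q z * (z\<^sup>2 / (4 * R) - R)\<bar> \<le> M * (Z\<^sup>2 / 4) * (2 / R\<^sup>2 * \<bar>r - R\<bar>)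
         + M * ((4 * Z + 3) * x / 4) * (2 / R) + 2 * L * x * (3 * R / 2) + M * \<bar>r - R\<bar>"
        unfolding e using t1 t2 t3 t4 by linarith
      also have "\<dots> = K1 * \<bar>r - R\<bar> + K2 * x"
        using R by (simp add: K1_def K2_def field_simps)
      finally have c1: "\<bar>c\<bar> \<le> h z + K1 * \<bar>r - R\<bar> + K2 * x"
        unfolding h_def using q[of z] abs_mult[of "q z" "z\<^sup>2 / (4 * R) - R"]
          abs_triangle_ineq2[of c "q z * (z\<^sup>2 / (4 * R) - R)"] by simp
      \<comment> \<open>Transfers the bound from z to z' = z + 2x: the first product below is
        controlled by the Lipschitz bound for q, the second by the growth of z^2/(4R) - R on the
        support of q.\<close>
      have h1: "h z \<le> h z' + K3 * x"
      proof -
        define g where "g y = y\<^sup>2 / (4 * R) - R" for y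
        have "h z - h z' = (q z - q z') * \<bar>g z\<bar> + q z' * (\<bar>g z\<bar> - \<bar>g z'\<bar>)"
          by (simp add: h_def g_def algebra_simps)
        moreover have "(q z - q z') * \<bar>g z\<bar> \<le> 2 * L * x * (Z\<^sup>2 / (4 * R) + R)"
        proof -
          have "q z - q z' \<le> 2 * L * x" using L[of z z'] x by (simp add: zz algebra_simps)
          moreover have "\<bar>g z\<bar> \<le> Z\<^sup>2 / (4 * R) + R"
          proof -
            have "0 \<le> z\<^sup>2 / (4 * R)" "z\<^sup>2 / (4 * R) \<le> Z\<^sup>2 / (4 * R)"
              using z0 zZ R by (auto intro!: divide_right_mono power_mono)
            then show ?thesis unfolding g_def using R by linarith
          qed
          ultimately show ?thesis using L0 x by (intro mult_mono) auto
        qed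
        moreover have "q z' * (\<bar>g z\<bar> - \<bar>g z'\<bar>) \<le> M * (Z / R * x)"
        proof (cases "z' \<ge> Z")
          case True
          then show ?thesis using Z M R x by auto
        next
          case False
          have "g z' - g z = (z + x) / R * x"
            using R by (simp add: g_def zz power2_eq_square field_simps)
          also have "\<dots> \<le> Z / R * x" using False zz x R by (intro mult_right_mono divide_right_mono) auto
          finally have "g z' - g z \<le> Z / R * x" .
          moreover have "g z' - g z \<ge> 0"
            using zz z0 x R by (auto simp: g_def intro!: divide_right_mono power_mono)
          ultimately have "\<bar>g z\<bar> - \<bar>g z'\<bar> \<le> Z / R * x" by linarith
          then have "q z' * (\<bar>g z\<bar> - \<bar>g z'\<bar>) \<le> q z' * (Z / R * x)"
            using q[of z'] by (intro mult_left_mono) auto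
          also have "\<dots> \<le> M * (Z / R * x)" using q[of z'] Z R x by (intro mult_right_mono) auto
          finally show ?thesis .
        qed
        ultimately show ?thesis unfolding K3_def by (simp add: algebra_simps)
      qed
      have "K2 * x \<le> K2 * (Z * (1 / real n))" "K3 * x \<le> K3 * (Z * (1 / real n))"
        using mult_left_mono[OF xn K0(2)] mult_left_mono[OF xn K0(3)] by auto
      moreover have "K * (\<bar>r - R\<bar> + 1 / real n) = K1 * \<bar>r - R\<bar> + K2 * (Z * (1 / real n)) + K3 * (Z * (1 / real n)) +
          K1 * (1 / real n) + (K2 + K3) * Z * \<bar>r - R\<bar>"
        by (simp add: K_def algebra_simps)
      moreover have "K1 * (1 / real n) \<ge> 0" "(K2 + K3) * Z * \<bar>r - R\<bar> \<ge> 0" "K3 * (Z * (1 / real n)) \<ge> 0"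
        using K0 Z by auto
      ultimately show ?thesis using c1 h1 by linarith
    qed
    then show "\<bar>c\<bar> \<le> h ((2 * real n - 1) * x) + K * (\<bar>r - R\<bar> + 1 / real n) \<and>
      \<bar>c\<bar> \<le> h ((2 * real n + 1) * x) + K * (\<bar>r - R\<bar> + 1 / real n)"
      by (simp add: z_def z'_def)
  qed
qed

text \<open>After summation \<open>J (Suc n)\<close> carries the coefficient
  \<open>d n - g (Suc n)\<close>. Its product with J is split into two halves, charged to
  \<open>h n * e (Suc n)\<close> and \<open>h (Suc n) * e (Suc (Suc n))\<close>; this is why both
  bounds \<open>dg\<close> are assumed. Only the fluxes at the two ends remain.\<close>

lemma telescoping_energy_sum:
  fixes B \<phi> d g h J e :: "nat \<Rightarrow> real"
  assumes step: "\<And>n. n \<ge> n0 \<Longrightarrow> B n \<le> \<phi> n + d n * J (Suc n) - g n * J n"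
    and J: "\<And>n. \<bar>J n\<bar> \<le> (e n + e (Suc n)) / 2" and e: "\<And>n. e n \<ge> 0" and h: "\<And>n. h n \<ge> 0"
    and dg: "\<And>n. n \<ge> n0 \<Longrightarrow> \<bar>d n - g (Suc n)\<bar> \<le> h n" "\<And>n. n \<ge> n0 \<Longrightarrow> \<bar>d n - g (Suc n)\<bar> \<le> h (Suc n)"
    and G: "\<bar>g n0\<bar> \<le> G" and P: "P \<ge> n0" and dP: "\<bar>d P\<bar> \<le> G"
  shows "(\<Sum>n=n0..P. B n) \<le> (\<Sum>n=n0..P. \<phi> n) + (\<Sum>n=n0..P. h n * e (Suc n))
     + G * (e n0 + e (Suc n0) + e (Suc P) + e (Suc (Suc P)))"
proof -
  \<comment> \<open>The strengthened claim keeps the open flux term at P and records that half of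
    \<open>h P * e (Suc P)\<close> is still unspent; the next step uses both.\<close>
  have "(\<Sum>n=n0..P. B n) \<le> (\<Sum>n=n0..P. \<phi> n) + (\<Sum>n=n0..P. h n * e (Suc n))
     - h P * e (Suc P) / 2 + d P * J (Suc P) + G * (e n0 + e (Suc n0))"
    using P
  proof (induction P rule: dec_induct)
    case base
    have "\<bar>g n0 * J n0\<bar> \<le> G * ((e n0 + e (Suc n0)) / 2)"
      unfolding abs_mult using G J[of n0] e by (intro mult_mono) auto
    moreover have "h n0 * e (Suc n0) \<ge> 0" "G * (e n0 + e (Suc n0)) \<ge> 0" using h e G by (auto intro!: mult_nonneg_nonneg add_nonneg_nonneg)
    ultimately show ?case using step[of n0] by (simp add: field_simps)
  next
    case (step P)
    have "(d P - g (Suc P)) * J (Suc P) \<le> \<bar>d P - g (Suc P)\<bar> * ((e (Suc P) + e (Suc (Suc P))) / 2)"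
      using mult_left_mono[OF J[of "Suc P"], of "\<bar>d P - g (Suc P)\<bar>"]
        abs_ge_self[of "(d P - g (Suc P)) * J (Suc P)"] by (simp add: abs_mult)
    also have "\<dots> = \<bar>d P - g (Suc P)\<bar> * (e (Suc P) / 2) + \<bar>d P - g (Suc P)\<bar> * (e (Suc (Suc P)) / 2)"
      by (simp add: field_simps)
    also have "\<dots> \<le> h P * (e (Suc P) / 2) + h (Suc P) * (e (Suc (Suc P)) / 2)"
      using dg[of P] step.hyps e by (intro add_mono mult_right_mono) auto
    finally have 1: "(d P - g (Suc P)) * J (Suc P) \<le> h P * (e (Suc P) / 2) + h (Suc P) * (e (Suc (Suc P)) / 2)" .
    have 2: "B (Suc P) \<le> \<phi> (Suc P) + d (Suc P) * J (Suc (Suc P)) - g (Suc P) * J (Suc P)"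
      using assms(1)[of "Suc P"] step.hyps by simp
    show ?case using step.IH 1 2 step.hyps by (simp add: algebra_simps)
  qed
  moreover have "d P * J (Suc P) \<le> G * (e (Suc P) + e (Suc (Suc P)))"
  proof -
    have "d P * J (Suc P) \<le> \<bar>d P\<bar> * \<bar>J (Suc P)\<bar>" by (simp flip: abs_mult)
    also have "\<dots> \<le> G * ((e (Suc P) + e (Suc (Suc P))) / 2)"
      using dP J[of "Suc P"] by (intro mult_mono) auto
    also have "\<dots> \<le> G * (e (Suc P) + e (Suc (Suc P)))"
      using dP e[of "Suc P"] e[of "Suc (Suc P)"] by (intro mult_left_mono) auto
    finally show ?thesis .
  qed
  moreover have "h P * e (Suc P) / 2 \<ge> 0" using h e by simp
  ultimately show ?thesis by (simp add: distrib_left)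
qed

section \<open>Energy estimates\<close>

context singular_ode begin

text \<open>Integration by parts in x^2 a' lowers the coefficient 2(n+1)x to (2n+1)x, and the
  coupling with \<open>A \<rho> n\<close> is a total derivative because its derivative is a multiple
  of \<open>A \<rho> (Suc n)\<close>.\<close>

lemma real_part_energy:
  assumes n: "n \<ge> 1" and \<rho>: "\<rho> n > 0" "\<rho> (n+1) > 0"
  shows "integral {0..1} (\<lambda>x. ((2 * real n + 1) * x + Re s) * (cmod (A \<rho> (Suc n) x))\<^sup>2) \<le>
     integral {0..1} (\<lambda>x. cmod (F \<rho> n x) * cmod (A \<rho> (Suc n) x))
       + (\<rho> n)\<^sup>2 / (2 * (real n * real (n + 1))) * (cmod (A \<rho> n 0))\<^sup>2"
proof -
  define a where "a = A \<rho> (Suc n)"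
  define b where "b = A \<rho> n"
  define a' where "a' x = of_real (real (n+1) * real (n + 2) / \<rho> (n+1)) * A \<rho> (n+2) x" for x
  define c where "c = real n * real (n + 1) / \<rho> n"
  have c: "c > 0" using n \<rho> by (simp add: c_def)
  have da: "(a has_vector_derivative a' x) (at x within {0..1})" if "x \<in> {0..1}" for x
    using A_deriv[OF that, of "n+1" \<rho>] \<rho> by (simp add: a_def a'_def numeral_2_eq_2)
  have db: "(b has_vector_derivative of_real c * a x) (at x within {0..1})" if "x \<in> {0..1}" for x
    using A_deriv[OF that n] \<rho> by (simp add: a_def b_def c_def)
  have dna: "((\<lambda>x. a x \<bullet> a x) has_vector_derivative a x \<bullet> a' x + a' x \<bullet> a x) (at x within {0..1})" if "x \<in> {0..1}" for x
    by (rule bounded_bilinear.has_vector_derivative[OF bounded_bilinear_inner da[OF that] da[OF that]])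
  have dnb: "((\<lambda>x. b x \<bullet> b x) has_vector_derivative b x \<bullet> (of_real c * a x) + (of_real c * a x) \<bullet> b x) (at x within {0..1})"
    if "x \<in> {0..1}" for x
    by (rule bounded_bilinear.has_vector_derivative[OF bounded_bilinear_inner db[OF that] db[OF that]])
  have "((\<lambda>x. x\<^sup>2 * (a x \<bullet> a' x + a' x \<bullet> a x) + 2 * x * (a x \<bullet> a x)) has_integral (1\<^sup>2 * (a 1 \<bullet> a 1) - 0\<^sup>2 * (a 0 \<bullet> a 0))) {0..1}"
  proof (rule fundamental_theorem_of_calculus)
    fix x :: real assume x: "x \<in> {0..1}"
    have "((\<lambda>x::real. x\<^sup>2) has_vector_derivative 2 * x) (at x within {0..1})"
      unfolding has_real_derivative_iff_has_vector_derivative[symmetric]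
      by (auto intro!: derivative_eq_intros)
    from has_vector_derivative_mult[OF this dna[OF x]]
    show "((\<lambda>x. x\<^sup>2 * (a x \<bullet> a x)) has_vector_derivative x\<^sup>2 * (a x \<bullet> a' x + a' x \<bullet> a x) + 2 * x * (a x \<bullet> a x)) (at x within {0..1})" .
  qed simp
  then have I1: "((\<lambda>x. x\<^sup>2 * (a x \<bullet> a' x + a' x \<bullet> a x) + 2 * x * (a x \<bullet> a x)) has_integral (a 1 \<bullet> a 1)) {0..1}"
    by simp
  have I2: "((\<lambda>x. b x \<bullet> (of_real c * a x) + (of_real c * a x) \<bullet> b x) has_integral (b 1 \<bullet> b 1 - b 0 \<bullet> b 0)) {0..1}"
    by (rule fundamental_theorem_of_calculus) (use dnb in auto)
  have contF: "continuous_on {0..1} (F \<rho> n)" using n \<rho> by (intro F_cont) auto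
  have conta: "continuous_on {0..1} a" unfolding a_def by (rule A_cont)
  have I3: "((\<lambda>x. F \<rho> n x \<bullet> a x) has_integral integral {0..1} (\<lambda>x. F \<rho> n x \<bullet> a x)) {0..1}"
    by (intro integrable_integral integrable_continuous_real continuous_intros contF conta)
  \<comment> \<open>Subtracting the two total derivatives from F . a leaves exactly the weighted
    square of a, as \<open>eq\<close> verifies.\<close>
  have I: "((\<lambda>x. F \<rho> n x \<bullet> a x - (1/2) * (x\<^sup>2 * (a x \<bullet> a' x + a' x \<bullet> a x) + 2 * x * (a x \<bullet> a x))
       - \<rho> n / (2 * c) * (b x \<bullet> (of_real c * a x) + (of_real c * a x) \<bullet> b x)) has_integral
      (integral {0..1} (\<lambda>x. F \<rho> n x \<bullet> a x) - (1/2) * (a 1 \<bullet> a 1) - \<rho> n / (2 * c) * (b 1 \<bullet> b 1 - b 0 \<bullet> b 0))) {0..1}"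
    by (intro has_integral_diff has_integral_mult_right I1 I2 I3)
  have eq: "F \<rho> n x \<bullet> a x - (1/2) * (x\<^sup>2 * (a x \<bullet> a' x + a' x \<bullet> a x) + 2 * x * (a x \<bullet> a x))
       - \<rho> n / (2 * c) * (b x \<bullet> (of_real c * a x) + (of_real c * a x) \<bullet> b x) =
      ((2 * real n + 1) * x + Re s) * (cmod (a x))\<^sup>2" if x: "x \<in> {0..1}" for x
  proof -
    have "F \<rho> n x = of_real (x\<^sup>2) * a' x + (of_real (2 * real (n+1) * x) + s) * a x + of_real (\<rho> n) * b x"
      using A_ode[OF x n] \<rho> by (simp add: a_def a'_def b_def mult.assoc)
    then have "F \<rho> n x \<bullet> a x = x\<^sup>2 * (a' x \<bullet> a x) + (2 * real (n+1) * x + Re s) * (a x \<bullet> a x) + \<rho> n * (b x \<bullet> a x)"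
      by (simp add: inner_complex_def algebra_simps)
    moreover have "(of_real c * a x) \<bullet> b x = c * (b x \<bullet> a x)" "b x \<bullet> (of_real c * a x) = c * (b x \<bullet> a x)"
      by (simp_all add: inner_complex_def algebra_simps)
    moreover have "a x \<bullet> a' x = a' x \<bullet> a x" by (rule inner_commute)
    moreover have "(cmod (a x))\<^sup>2 = a x \<bullet> a x" by (rule power2_norm_eq_inner)
    ultimately show ?thesis using c by (simp add: algebra_simps)
  qed
  have "integral {0..1} (\<lambda>x. ((2 * real n + 1) * x + Re s) * (cmod (a x))\<^sup>2) =
     integral {0..1} (\<lambda>x. F \<rho> n x \<bullet> a x) - (1/2) * (a 1 \<bullet> a 1) - \<rho> n / (2 * c) * (b 1 \<bullet> b 1 - b 0 \<bullet> b 0)"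
    using has_integral_eq[OF eq I] by (rule integral_unique)
  \<comment> \<open>Both boundary terms at x = 1 have a favourable sign and are dropped; only the
    one at the origin survives.\<close>
  also have "\<dots> \<le> integral {0..1} (\<lambda>x. F \<rho> n x \<bullet> a x) + \<rho> n / (2 * c) * (b 0 \<bullet> b 0)"
  proof -
    have "\<rho> n / (2 * c) * (b 1 \<bullet> b 1) \<ge> 0" using \<rho> c by simp
    then show ?thesis using inner_ge_zero[of "a 1"] unfolding right_diff_distrib by linarith
  qed
  also have "integral {0..1} (\<lambda>x. F \<rho> n x \<bullet> a x) \<le> integral {0..1} (\<lambda>x. cmod (F \<rho> n x) * cmod (a x))"
    by (intro integral_le integrable_continuous_real continuous_intros contF conta norm_cauchy_schwarz)
  also have "\<rho> n / (2 * c) * (b 0 \<bullet> b 0) = (\<rho> n)\<^sup>2 / (2 * (real n * real (n + 1))) * (cmod (A \<rho> n 0))\<^sup>2"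
    using \<rho> unfolding power2_norm_eq_inner by (simp add: c_def b_def power2_eq_square)
  finally show ?thesis by (simp add: a_def)
qed

text \<open>The factor \<open>sgn (Im s)\<close> is included so that the imaginary part of the
  equation produces |Im s|.\<close>

definition flux :: "(nat \<Rightarrow> real) \<Rightarrow> nat \<Rightarrow> real \<Rightarrow> real" where
  "flux \<rho> n x = - sgn (Im s) * Im (A \<rho> (Suc n) x * cnj (A \<rho> n x))"

lemma flux_bound: "\<bar>flux \<rho> n x\<bar> \<le> ((cmod (A \<rho> n x))\<^sup>2 + (cmod (A \<rho> (Suc n) x))\<^sup>2) / 2"
proof -
  have "\<bar>flux \<rho> n x\<bar> \<le> 1 * cmod (A \<rho> (Suc n) x * cnj (A \<rho> n x))"
    unfolding flux_def abs_mult abs_minus_cancel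
    by (intro mult_mono abs_Im_le_cmod) (auto simp: sgn_real_def)
  also have "\<dots> = cmod (A \<rho> (Suc n) x) * cmod (A \<rho> n x)" by (simp add: norm_mult)
  also have "\<dots> \<le> ((cmod (A \<rho> n x))\<^sup>2 + (cmod (A \<rho> (Suc n) x))\<^sup>2) / 2"
    using sum_squares_bound[of "cmod (A \<rho> (Suc n) x)" "cmod (A \<rho> n x)"] by simp
  finally show ?thesis .
qed

text \<open>Multiplying by the conjugate of \<open>A \<rho> (Suc n)\<close> and taking imaginary
  parts removes the real coefficient 2(n+1)x. The neighbouring orders enter only through fluxes, so
  the inequality is pointwise in x and can be telescoped in n.\<close>

lemma imaginary_part_energy:
  assumes x: "x \<in> {0..1}" and n: "n \<ge> 1" and \<rho>: "\<rho> (n+1) \<noteq> 0"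
  shows "\<bar>Im s\<bar> * (cmod (A \<rho> (Suc n) x))\<^sup>2 \<le> cmod (F \<rho> n x) * cmod (A \<rho> (Suc n) x)
     + x\<^sup>2 * real (n + 1) * real (n + 2) / \<rho> (n + 1) * flux \<rho> (Suc n) x - \<rho> n * flux \<rho> n x"
proof -
  define a where "a = A \<rho> (Suc n) x"
  define c where "c = x\<^sup>2 * real (n + 1) * real (n + 2) / \<rho> (n + 1)"
  have "F \<rho> n x = of_real c * A \<rho> (n+2) x + (of_real (2 * real (n+1) * x) + s) * a + of_real (\<rho> n) * A \<rho> n x"
    using A_ode[OF x n, of \<rho>] \<rho> by (simp add: a_def c_def)
  then have "Im (F \<rho> n x * cnj a) = c * Im (A \<rho> (n+2) x * cnj a) + Im s * (cmod a)\<^sup>2 - \<rho> n * Im (a * cnj (A \<rho> n x))"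
    unfolding cmod_power2 by (simp add: algebra_simps power2_eq_square)
  moreover have "sgn (Im s) * (c * X + Im s * Y - \<rho> n * T) = \<bar>Im s\<bar> * Y - c * (- sgn (Im s) * X) + \<rho> n * (- sgn (Im s) * T)" for X Y T
    by (simp add: algebra_simps abs_sgn)
  ultimately have "sgn (Im s) * Im (F \<rho> n x * cnj a) = \<bar>Im s\<bar> * (cmod a)\<^sup>2 - c * flux \<rho> (Suc n) x + \<rho> n * flux \<rho> n x"
    by (simp only: flux_def a_def) simp
  moreover have "sgn (Im s) * Im (F \<rho> n x * cnj a) \<le> 1 * cmod (F \<rho> n x * cnj a)"
  proof -
    have "sgn (Im s) * Im (F \<rho> n x * cnj a) \<le> \<bar>sgn (Im s)\<bar> * \<bar>Im (F \<rho> n x * cnj a)\<bar>"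
      unfolding abs_mult[symmetric] by (rule abs_ge_self)
    also have "\<dots> \<le> 1 * cmod (F \<rho> n x * cnj a)"
      by (intro mult_mono abs_Im_le_cmod) (auto simp: sgn_real_def)
    finally show ?thesis .
  qed
  ultimately show ?thesis by (simp add: a_def c_def norm_mult)
qed

text \<open>The real part identity contributes z + Re s, the localised imaginary part contributes
  q(z)(|Im s| - |z^2/(4R) - R|), and hypothesis \<open>\<kappa>\<close> makes their sum coercive.
  The losses are the cutoff error, the potential, the boundary values at 0, and the energies at the
  two ends of the summation.\<close>

lemma energy_estimate:
  fixes q :: "real \<Rightarrow> real" and R M Z K D \<theta> :: real
  defines "h \<equiv> \<lambda>z. q z * \<bar>z\<^sup>2 / (4 * R) - R\<bar>"
    and "G \<equiv> 2 * M * R + 2 * M * Z\<^sup>2 / R"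
  assumes R: "R > 0" and q: "\<And>z. 0 \<le> q z \<and> q z \<le> M"
    and Z: "Z \<ge> 0" "\<And>z. z \<ge> Z \<Longrightarrow> q z = 0"
    and \<kappa>: "\<And>z. z \<ge> 0 \<Longrightarrow> q z * (\<bar>Im s\<bar> - \<bar>z\<^sup>2 / (4 * R) - R\<bar>) + z + Re s \<ge> \<kappa>"
    and cutoff: "\<And>n x r c. n \<ge> 1 \<Longrightarrow> x \<in> {0..1} \<Longrightarrow> \<bar>r - R\<bar> \<le> R / 2 \<Longrightarrow>
      c = q ((2 * real n - 1) * x) * (x\<^sup>2 * real n * (real n + 1) / r) - q ((2 * real n + 1) * x) * r \<Longrightarrow>
      \<bar>c\<bar> \<le> h ((2 * real n - 1) * x) + K * (\<bar>r - R\<bar> + 1 / real n) \<and>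
      \<bar>c\<bar> \<le> h ((2 * real n + 1) * x) + K * (\<bar>r - R\<bar> + 1 / real n)"
    and \<rho>: "\<And>i. \<bar>\<rho> i - R\<bar> \<le> R / 2"
    and F: "\<And>n x. n \<ge> 1 \<Longrightarrow> x \<in> {0..1} \<Longrightarrow>
     cmod (F \<rho> n x) \<le> D / (real n * real (n + 1)) * (\<Sum>m\<le>n. cmod (A \<rho> m x))" and D: "D \<ge> 0"
    and \<theta>: "\<And>n i. n \<ge> n0 \<Longrightarrow> K * (\<bar>\<rho> i - R\<bar> + 1 / real n) \<le> \<theta>" "\<theta> \<ge> 0"
    and n0: "n0 \<ge> 1" "n0 \<le> P"
  shows "\<kappa> * (\<Sum>n=n0..P. energy \<rho> (Suc n)) \<le> \<theta> * (\<Sum>n=n0..P. energy \<rho> (Suc n))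
    + (1 + M) * (\<Sum>n=n0..P. D / (2 * (real n * real (n + 1))) * (\<Sum>m\<le>n. energy \<rho> m + energy \<rho> (Suc n)))
    + (\<Sum>n=n0..P. (\<rho> n)\<^sup>2 / (2 * (real n * real (n + 1))) * (cmod (A \<rho> n 0))\<^sup>2)
    + G * (energy \<rho> n0 + energy \<rho> (Suc n0) + energy \<rho> (Suc P) + energy \<rho> (Suc (Suc P)))"
proof -
  define e where "e n x = (cmod (A \<rho> n x))\<^sup>2" for n x
  define \<phi> where "\<phi> n x = D / (2 * (real n * real (n + 1))) * (\<Sum>m\<le>n. e m x + e (Suc n) x)" for n x
  define z where "z n x = (2 * real n + 1) * x" for n and x :: real
  have M: "M \<ge> 0" using q[of 0] by simp
  have \<rho>': "\<rho> i \<ge> R / 2" "\<rho> i \<le> 3 * R / 2" "\<rho> i > 0" for i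
    using \<rho>[of i] R unfolding abs_le_iff by linarith+
  have h0: "h z \<ge> 0" for z using q by (simp add: h_def)
  have e0: "e n x \<ge> 0" for n x by (simp add: e_def)
  have \<phi>: "cmod (F \<rho> n x) * cmod (A \<rho> (Suc n) x) \<le> \<phi> n x" if "n \<ge> 1" "x \<in> {0..1}" for n x
  proof -
    have "cmod (F \<rho> n x) * cmod (A \<rho> (Suc n) x) \<le> D / (real n * real (n + 1)) * (\<Sum>m\<le>n. cmod (A \<rho> m x)) * cmod (A \<rho> (Suc n) x)"
      using F[OF that] by (intro mult_right_mono) auto
    also have "\<dots> = D / (real n * real (n + 1)) * (\<Sum>m\<le>n. cmod (A \<rho> m x) * cmod (A \<rho> (Suc n) x))"
      by (simp add: sum_distrib_right)
    also have "\<dots> \<le> D / (real n * real (n + 1)) * (\<Sum>m\<le>n. (e m x + e (Suc n) x) / 2)"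
    proof (intro mult_left_mono sum_mono)
      show "cmod (A \<rho> m x) * cmod (A \<rho> (Suc n) x) \<le> (e m x + e (Suc n) x) / 2" for m
        using sum_squares_bound[of "cmod (A \<rho> m x)" "cmod (A \<rho> (Suc n) x)"] by (simp add: e_def)
    qed (use D in auto)
    also have "\<dots> = \<phi> n x" by (simp add: \<phi>_def flip: sum_divide_distrib)
    finally show ?thesis .
  qed
  have \<phi>0: "\<phi> n x \<ge> 0" for n x
    unfolding \<phi>_def using D e0 by (intro mult_nonneg_nonneg sum_nonneg add_nonneg_nonneg) auto
  have econt: "continuous_on {0..1} (e n)" for n
    unfolding e_def[abs_def] by (intro continuous_intros)
  have \<phi>cont: "continuous_on {0..1} (\<phi> n)" for n
    unfolding \<phi>_def[abs_def] by (intro continuous_intros econt)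
  \<comment> \<open>The imaginary part is summed over n at fixed x, since its cutoff depends on n
    and x together; integration follows afterwards.\<close>
  have pw: "\<kappa> * (\<Sum>n=n0..P. e (Suc n) x) \<le> (\<Sum>n=n0..P. (z n x + Re s) * e (Suc n) x)
     + M * (\<Sum>n=n0..P. \<phi> n x) + \<theta> * (\<Sum>n=n0..P. e (Suc n) x)
     + G * (e n0 x + e (Suc n0) x + e (Suc P) x + e (Suc (Suc P)) x)"
    if x: "x \<in> {0..1}" for x
  proof -
    have "(\<Sum>n=n0..P. \<bar>Im s\<bar> * q (z n x) * e (Suc n) x) \<le> (\<Sum>n=n0..P. M * \<phi> n x)
       + (\<Sum>n=n0..P. (h (z n x) + \<theta>) * e (Suc n) x)
       + G * (e n0 x + e (Suc n0) x + e (Suc P) x + e (Suc (Suc P)) x)"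
    proof (rule telescoping_energy_sum[where J="\<lambda>n. flux \<rho> n x" and
            d="\<lambda>n. q (z n x) * (x\<^sup>2 * real (n + 1) * real (n + 2) / \<rho> (n + 1))" and g="\<lambda>n. q (z n x) * \<rho> n"])
      fix n assume n: "n0 \<le> n"
      have n1: "n \<ge> 1" using n n0 by simp
      have "q (z n x) * (\<bar>Im s\<bar> * e (Suc n) x) \<le> q (z n x) * (\<phi> n x
          + x\<^sup>2 * real (n + 1) * real (n + 2) / \<rho> (n + 1) * flux \<rho> (Suc n) x - \<rho> n * flux \<rho> n x)"
        using imaginary_part_energy[OF x n1, of \<rho>] \<phi>[OF n1 x] \<rho>'(3)[of "n+1"] q
        by (intro mult_left_mono) (auto simp: e_def)
      moreover have "q (z n x) * \<phi> n x \<le> M * \<phi> n x" using q \<phi>0 by (intro mult_right_mono) auto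
      ultimately show "\<bar>Im s\<bar> * q (z n x) * e (Suc n) x \<le> M * \<phi> n x +
          q (z n x) * (x\<^sup>2 * real (n + 1) * real (n + 2) / \<rho> (n + 1)) * flux \<rho> (Suc n) x - q (z n x) * \<rho> n * flux \<rho> n x"
        by (simp add: algebra_simps)
      have c: "\<bar>q (z n x) * (x\<^sup>2 * real (n + 1) * real (n + 2) / \<rho> (n + 1)) - q (z (Suc n) x) * \<rho> (Suc n)\<bar>
         \<le> h (z n x) + K * (\<bar>\<rho> (Suc n) - R\<bar> + 1 / real (Suc n)) \<and>
        \<bar>q (z n x) * (x\<^sup>2 * real (n + 1) * real (n + 2) / \<rho> (n + 1)) - q (z (Suc n) x) * \<rho> (Suc n)\<bar>
         \<le> h (z (Suc n) x) + K * (\<bar>\<rho> (Suc n) - R\<bar> + 1 / real (Suc n))"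
      proof -
        have z1: "z n x = (2 * real (Suc n) - 1) * x" "z (Suc n) x = (2 * real (Suc n) + 1) * x"
          by (simp_all add: z_def algebra_simps)
        show ?thesis unfolding z1 by (rule cutoff) (use x \<rho> in \<open>auto simp: add.commute\<close>)
      qed
      have t: "K * (\<bar>\<rho> (Suc n) - R\<bar> + 1 / real (Suc n)) \<le> \<theta>"
        using \<theta>(1)[of "Suc n" "Suc n"] n by simp
      show "\<bar>q (z n x) * (x\<^sup>2 * real (n + 1) * real (n + 2) / \<rho> (n + 1)) - q (z (Suc n) x) * \<rho> (Suc n)\<bar>
         \<le> h (z n x) + \<theta>" using c t by linarith
      show "\<bar>q (z n x) * (x\<^sup>2 * real (n + 1) * real (n + 2) / \<rho> (n + 1)) - q (z (Suc n) x) * \<rho> (Suc n)\<bar>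
         \<le> h (z (Suc n) x) + \<theta>" using c t by linarith
    next
      show "\<bar>flux \<rho> n x\<bar> \<le> (e n x + e (Suc n) x) / 2" for n
        using flux_bound[of \<rho> n x] by (simp add: e_def)
      show "0 \<le> h (z n x) + \<theta>" for n using h0 \<theta> by simp
      have MR: "M * R \<ge> 0" "M * Z\<^sup>2 / R \<ge> 0" using M R by auto
      have "\<bar>q (z n0 x) * \<rho> n0\<bar> \<le> M * (2 * R)"
        unfolding abs_mult using q[of "z n0 x"] \<rho>'[of n0] R by (intro mult_mono) auto
      then show "\<bar>q (z n0 x) * \<rho> n0\<bar> \<le> G" unfolding G_def using MR by simp
      \<comment> \<open>On the support of q one has (2P+1)x < Z, and (P+1)(P+2) is at most (2P+1)^2
        because P is at least 1; so the end coefficient is bounded independently of P.\<close>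
      show "\<bar>q (z P x) * (x\<^sup>2 * real (P + 1) * real (P + 2) / \<rho> (P + 1))\<bar> \<le> G"
      proof (cases "z P x \<ge> Z")
        case True
        then show ?thesis using Z MR by (simp add: G_def)
      next
        case False
        have P1: "real P \<ge> 1" using n0 by simp
        have PP: "real P * 1 \<le> real P * real P" using P1 by (intro mult_left_mono) auto
        have "x\<^sup>2 * real (P + 1) * real (P + 2) \<le> x\<^sup>2 * (2 * real P + 1)\<^sup>2"
        proof -
          have "real (P + 1) * real (P + 2) = real P * real P + 3 * real P + 2" by (simp add: algebra_simps)
          also have "\<dots> \<le> 4 * (real P * real P) + 4 * real P + 1" using P1 PP by linarith
          also have "\<dots> = (2 * real P + 1)\<^sup>2" by (simp add: power2_eq_square algebra_simps)
          finally show ?thesis unfolding mult.assoc by (intro mult_left_mono) auto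
        qed
        also have "\<dots> = (z P x)\<^sup>2" by (simp add: z_def power_mult_distrib mult.commute)
        also have "\<dots> \<le> Z\<^sup>2" using False x by (intro power_mono) (auto simp: z_def)
        finally have "x\<^sup>2 * real (P + 1) * real (P + 2) / \<rho> (P + 1) \<le> Z\<^sup>2 / (R / 2)"
          using \<rho>'[of "P+1"] R by (intro frac_le) auto
        moreover have "0 \<le> x\<^sup>2 * real (P + 1) * real (P + 2) / \<rho> (P + 1)"
          using \<rho>'(3)[of "P+1"] by (simp del: of_nat_add)
        ultimately have "\<bar>q (z P x) * (x\<^sup>2 * real (P + 1) * real (P + 2) / \<rho> (P + 1))\<bar> \<le> M * (Z\<^sup>2 / (R / 2))"
          unfolding abs_mult using q[of "z P x"] by (intro mult_mono) auto
        moreover have "M * (Z\<^sup>2 / (R / 2)) = 2 * M * Z\<^sup>2 / R" by simp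
        ultimately show ?thesis unfolding G_def using MR by linarith
      qed
    qed (use e0 n0 in auto)
    moreover have "\<kappa> * (\<Sum>n=n0..P. e (Suc n) x) \<le> (\<Sum>n=n0..P. (z n x + Re s) * e (Suc n) x)
       + (\<Sum>n=n0..P. \<bar>Im s\<bar> * q (z n x) * e (Suc n) x) - (\<Sum>n=n0..P. h (z n x) * e (Suc n) x)"
    proof -
      have "\<kappa> * (\<Sum>n=n0..P. e (Suc n) x) \<le> (\<Sum>n=n0..P. (q (z n x) * (\<bar>Im s\<bar> - \<bar>(z n x)\<^sup>2 / (4 * R) - R\<bar>) + z n x + Re s) * e (Suc n) x)"
        unfolding sum_distrib_left using x e0 by (intro sum_mono mult_right_mono \<kappa>) (auto simp: z_def)
      also have "\<dots> = (\<Sum>n=n0..P. (z n x + Re s) * e (Suc n) x)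
       + (\<Sum>n=n0..P. \<bar>Im s\<bar> * q (z n x) * e (Suc n) x) - (\<Sum>n=n0..P. h (z n x) * e (Suc n) x)"
        unfolding sum.distrib[symmetric] sum_subtractf[symmetric] h_def
        by (intro sum.cong) (auto simp: algebra_simps)
      finally show ?thesis .
    qed
    ultimately show ?thesis
      by (simp add: distrib_right sum.distrib flip: sum_distrib_left)
  qed
  have int: "g integrable_on {0..1}" if "continuous_on {0..1} g" for g :: "real \<Rightarrow> real"
    using that by (rule integrable_continuous_real)
  have zcont: "continuous_on {0..1} (\<lambda>x. (z n x + Re s) * e (Suc n) x)" for n
    unfolding z_def by (intro continuous_intros econt)
  have E: "integral {0..1} (e n) = energy \<rho> n" for n by (simp add: energy_def e_def[abs_def])
  have "integral {0..1} (\<lambda>x. \<kappa> * (\<Sum>n=n0..P. e (Suc n) x)) \<le> integral {0..1} (\<lambda>x. (\<Sum>n=n0..P. (z n x + Re s) * e (Suc n) x)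
     + M * (\<Sum>n=n0..P. \<phi> n x) + \<theta> * (\<Sum>n=n0..P. e (Suc n) x)
     + G * (e n0 x + e (Suc n0) x + e (Suc P) x + e (Suc (Suc P)) x))"
    by (intro integral_le int continuous_intros econt \<phi>cont zcont pw)
  also have "\<dots> = (\<Sum>n=n0..P. integral {0..1} (\<lambda>x. (z n x + Re s) * e (Suc n) x))
     + M * (\<Sum>n=n0..P. integral {0..1} (\<phi> n)) + \<theta> * (\<Sum>n=n0..P. energy \<rho> (Suc n))
     + G * (energy \<rho> n0 + energy \<rho> (Suc n0) + energy \<rho> (Suc P) + energy \<rho> (Suc (Suc P)))"
    by (intro integral_unique has_integral_add has_integral_sum has_integral_mult_right finite_atLeastAtMost)
       (auto intro!: integrable_integral int econt \<phi>cont zcont simp flip: E)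
  also have "integral {0..1} (\<lambda>x. \<kappa> * (\<Sum>n=n0..P. e (Suc n) x)) = \<kappa> * (\<Sum>n=n0..P. energy \<rho> (Suc n))"
    by (intro integral_unique has_integral_sum has_integral_mult_right finite_atLeastAtMost)
       (auto intro!: integrable_integral int econt simp flip: E)
  finally have 1: "\<kappa> * (\<Sum>n=n0..P. energy \<rho> (Suc n)) \<le> (\<Sum>n=n0..P. integral {0..1} (\<lambda>x. (z n x + Re s) * e (Suc n) x))
     + M * (\<Sum>n=n0..P. integral {0..1} (\<phi> n)) + \<theta> * (\<Sum>n=n0..P. energy \<rho> (Suc n))
     + G * (energy \<rho> n0 + energy \<rho> (Suc n0) + energy \<rho> (Suc P) + energy \<rho> (Suc (Suc P)))" .
  have I\<phi>: "integral {0..1} (\<phi> n) = D / (2 * (real n * real (n + 1))) * (\<Sum>m\<le>n. energy \<rho> m + energy \<rho> (Suc n))" for n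
    unfolding \<phi>_def[abs_def]
    by (intro integral_unique has_integral_add has_integral_sum has_integral_mult_right finite_atMost)
       (auto intro!: integrable_integral int econt simp flip: E)
  \<comment> \<open>The terms z + Re s left over by the pointwise estimate are exactly those
    controlled by the integrated real part.\<close>
  have "(\<Sum>n=n0..P. integral {0..1} (\<lambda>x. (z n x + Re s) * e (Suc n) x)) \<le>
     (\<Sum>n=n0..P. integral {0..1} (\<phi> n) + (\<rho> n)\<^sup>2 / (2 * (real n * real (n + 1))) * (cmod (A \<rho> n 0))\<^sup>2)"
  proof (intro sum_mono)
    fix n assume "n \<in> {n0..P}"
    then have n: "n \<ge> 1" using n0 by simp
    have "integral {0..1} (\<lambda>x. cmod (F \<rho> n x) * cmod (A \<rho> (Suc n) x)) \<le> integral {0..1} (\<phi> n)"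
      using n \<rho>'(3)[of "n+1"] by (intro integral_le int \<phi>cont continuous_intros F_cont \<phi>) auto
    then show "integral {0..1} (\<lambda>x. (z n x + Re s) * e (Suc n) x) \<le> integral {0..1} (\<phi> n) + (\<rho> n)\<^sup>2 / (2 * (real n * real (n + 1))) * (cmod (A \<rho> n 0))\<^sup>2"
      using real_part_energy[of n \<rho>, OF n \<rho>'(3) \<rho>'(3)] unfolding z_def e_def by linarith
  qed
  then show ?thesis using 1 unfolding sum.distrib I\<phi> by (simp add: algebra_simps)
qed

end

section \<open>Absorbing the potential terms\<close>

lemma sum_inverse_consecutive_le:
  assumes "n0 \<ge> (1::nat)"
  shows "(\<Sum>n=n0..P. 1 / (real n * real (n + 1))) \<le> 1 / real n0"
proof (cases "n0 \<le> P")
  case True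
  have "(\<Sum>n=n0..P. 1 / (real n * real (n + 1))) = 1 / real n0 - 1 / real (Suc P)"
    using True
  proof (induction P rule: dec_induct)
    case base
    then show ?case using assms by (simp add: field_simps)
  next
    case (step P)
    have "1 / (real (Suc P) * real (Suc P + 1)) = 1 / real (Suc P) - 1 / real (Suc (Suc P))"
      by (simp add: field_simps)
    then show ?case using step by simp
  qed
  then show ?thesis by simp
qed simp

text \<open>Every inner sum of \<open>E m\<close> is bounded by the total energy and the weights
  1/(n(n+1)) sum to at most 1/n0; the n + 1 copies of \<open>E (Suc n)\<close> cost a factor 1/n. A
  large \<open>n0\<close> thus makes the whole sum absorbable.\<close>

lemma convolution_sum_le:
  fixes E :: "nat \<Rightarrow> real"
  assumes E: "\<And>n. E n \<ge> 0" and D: "D \<ge> 0" and n0: "n0 \<ge> 1"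
  shows "(\<Sum>n=n0..P. D / (2 * (real n * real (n + 1))) * (\<Sum>m\<le>n. E m + E (Suc n)))
     \<le> D / (2 * real n0) * ((\<Sum>m\<le>n0. E m) + 2 * (\<Sum>n=n0..P. E (Suc n)))"
proof -
  define S where "S = (\<Sum>n=n0..P. E (Suc n))"
  define T where "T = (\<Sum>m\<le>n0. E m) + S"
  have T: "T \<ge> 0" unfolding T_def S_def using E by (intro add_nonneg_nonneg sum_nonneg) auto
  have "(\<Sum>n=n0..P. D / (2 * (real n * real (n + 1))) * (\<Sum>m\<le>n. E m + E (Suc n)))
    \<le> (\<Sum>n=n0..P. D / 2 * T * (1 / (real n * real (n + 1))) + D / (2 * real n0) * E (Suc n))"
  proof (intro sum_mono)
    fix n assume n: "n \<in> {n0..P}"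
    have n1: "real n > 0" "real n \<ge> real n0" "real n0 > 0" using n n0 by auto
    have "(\<Sum>m\<le>n. E m) \<le> sum E ({..n0} \<union> {Suc n0..Suc P})"
      using n E by (intro sum_mono2) auto
    also have "\<dots> \<le> (\<Sum>m\<le>n0. E m) + sum E {Suc n0..Suc P}"
      by (intro eq_refl sum.union_disjoint) auto
    also have "sum E {Suc n0..Suc P} = S" unfolding S_def by (rule sum.shift_bounds_cl_Suc_ivl)
    finally have 1: "(\<Sum>m\<le>n. E m) \<le> T" by (simp add: T_def)
    have "D / (2 * (real n * real (n + 1))) * (\<Sum>m\<le>n. E m + E (Suc n)) =
      D / (2 * (real n * real (n + 1))) * (\<Sum>m\<le>n. E m) + D / (2 * real n) * E (Suc n)"
    proof -
      have "D / (2 * (real n * real (n + 1))) * (real (n + 1) * E (Suc n)) = D / (2 * real n) * E (Suc n)"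
        using n1 by (simp add: divide_simps)
      then show ?thesis by (simp add: sum.distrib distrib_left)
    qed
    also have "\<dots> \<le> D / (2 * (real n * real (n + 1))) * T + D / (2 * real n0) * E (Suc n)"
      using 1 D E n1 by (intro add_mono mult_left_mono mult_right_mono divide_left_mono) auto
    finally show "D / (2 * (real n * real (n + 1))) * (\<Sum>m\<le>n. E m + E (Suc n)) \<le>
       D / 2 * T * (1 / (real n * real (n + 1))) + D / (2 * real n0) * E (Suc n)" by simp
  qed
  also have "\<dots> = D / 2 * T * (\<Sum>n=n0..P. 1 / (real n * real (n + 1))) + D / (2 * real n0) * S"
    unfolding sum.distrib S_def sum_distrib_left ..
  also have "\<dots> \<le> D / 2 * T * (1 / real n0) + D / (2 * real n0) * S"
    using D T by (intro add_right_mono mult_left_mono sum_inverse_consecutive_le n0) auto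
  also have "\<dots> = D / (2 * real n0) * (T + S)" by (simp add: distrib_left)
  also have "T + S = (\<Sum>m\<le>n0. E m) + 2 * (\<Sum>n=n0..P. E (Suc n))" by (simp add: T_def S_def)
  finally show ?thesis .
qed

section \<open>Admissible rates and the choice of cutoff\<close>

text \<open>R < |s| serves the recurrence at the origin. For R > 0 the last two inequalities express
  |Im s| > |z^2/(4R) - R| at z = 0 and z = - Re s, hence on the whole interval between them by
  monotonicity.\<close>

definition admissible :: "complex \<Rightarrow> real \<Rightarrow> bool" where
  "admissible s R \<longleftrightarrow> R < cmod s \<and> (Re s > 0 \<or> R < \<bar>Im s\<bar> \<and> (Re s)\<^sup>2 / 4 < R\<^sup>2 + \<bar>Im s\<bar> * R)"

text \<open>For Re s > 0 the real part alone is coercive and q = 0 works. Otherwise q is a plateau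
  of height M on the region where z + Re s may be negative, followed by a linear descent to
  0.\<close>

lemma cutoff_exists:
  assumes R: "R > 0" and adm: "admissible s R"
  obtains q :: "real \<Rightarrow> real" and M L Z \<kappa> where "\<kappa> > 0" "\<And>z. 0 \<le> q z \<and> q z \<le> M"
    "\<And>z z'. \<bar>q z - q z'\<bar> \<le> L * \<bar>z - z'\<bar>" "Z \<ge> 0" "\<And>z. z \<ge> Z \<Longrightarrow> q z = 0"
    "\<And>z. z \<ge> 0 \<Longrightarrow> q z * (\<bar>Im s\<bar> - \<bar>z\<^sup>2 / (4 * R) - R\<bar>) + z + Re s \<ge> \<kappa>"
proof (cases "Re s > 0")
  case True
  show thesis by (rule that[of "Re s" "\<lambda>_. 0" 0 0 0]) (use True in auto)
next
  case False
  define \<beta> where "\<beta> = - Re s"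
  define b where "b = \<bar>Im s\<bar>"
  have \<beta>: "\<beta> \<ge> 0" using False by (simp add: \<beta>_def)
  have bR: "b > R" and b2: "\<beta>\<^sup>2 / 4 < R\<^sup>2 + b * R"
    using adm False by (auto simp: admissible_def b_def \<beta>_def)
  define \<Delta> where "\<Delta> = 4 * R\<^sup>2 + 4 * b * R - \<beta>\<^sup>2"
  have \<Delta>: "\<Delta> > 0" using b2 by (simp add: \<Delta>_def)
  \<comment> \<open>Small enough that (4 \<open>\<beta>\<close> + 4) \<open>\<eta>\<close> is at
    most half of \<open>\<Delta>\<close>, so the strict inequality at z = \<open>\<beta>\<close>
    persists at z = \<open>\<beta> + 2 * \<eta>\<close>.\<close>
  define \<eta> where "\<eta> = min 1 (\<Delta> / (2 * (4 * \<beta> + 4)))"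
  have \<eta>: "\<eta> > 0" "\<eta> \<le> 1" using \<Delta> \<beta> by (auto simp: \<eta>_def)
  have "(\<beta> + 2 * \<eta>)\<^sup>2 < 4 * R\<^sup>2 + 4 * b * R"
  proof -
    have "\<eta> * \<eta> \<le> \<eta>" using \<eta> by (simp add: mult_left_le)
    then have "(\<beta> + 2 * \<eta>)\<^sup>2 \<le> \<beta>\<^sup>2 + (4 * \<beta> + 4) * \<eta>" by (simp add: power2_eq_square algebra_simps)
    also have "(4 * \<beta> + 4) * \<eta> \<le> (4 * \<beta> + 4) * (\<Delta> / (2 * (4 * \<beta> + 4)))"
      using \<beta> by (intro mult_left_mono) (auto simp: \<eta>_def)
    also have "\<dots> = \<Delta> / 2" using \<beta> by (simp add: field_simps)
    finally have "(\<beta> + 2 * \<eta>)\<^sup>2 \<le> \<beta>\<^sup>2 + \<Delta> / 2" by simp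
    then show ?thesis using \<Delta> unfolding \<Delta>_def by argo
  qed
  then have top: "(\<beta> + 2 * \<eta>)\<^sup>2 / (4 * R) - R < b"
    using R by (simp add: field_simps power2_eq_square)
  define c where "c = min (b - R) (b - ((\<beta> + 2 * \<eta>)\<^sup>2 / (4 * R) - R))"
  have c: "c > 0" using bR top by (simp add: c_def)
  have sym: "b - \<bar>z\<^sup>2 / (4 * R) - R\<bar> \<ge> c" if "0 \<le> z" "z \<le> \<beta> + 2 * \<eta>" for z
  proof -
    have "0 \<le> z\<^sup>2 / (4 * R)" "z\<^sup>2 / (4 * R) \<le> (\<beta> + 2 * \<eta>)\<^sup>2 / (4 * R)"
      using that R by (auto intro!: divide_right_mono power_mono)
    then have "\<bar>z\<^sup>2 / (4 * R) - R\<bar> \<le> max R ((\<beta> + 2 * \<eta>)\<^sup>2 / (4 * R) - R)" by linarith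
    then show ?thesis unfolding c_def by linarith
  qed
  \<comment> \<open>As c is a lower bound for |Im s| - |z^2/(4R) - R| on the support, this height
    yields M c = \<open>\<beta> + \<eta>\<close>, which outweighs Re s = -
    \<open>\<beta>\<close>.\<close>
  define M where "M = (\<beta> + \<eta>) / c"
  have M: "M \<ge> 0" using \<beta> \<eta> c by (simp add: M_def)
  define k where "k u = max 0 (min 1 u)" for u :: real
  define q where "q z = M * k ((\<beta> + 2 * \<eta> - z) / \<eta>)" for z
  have k: "0 \<le> k u" "k u \<le> 1" "\<bar>k u - k u'\<bar> \<le> \<bar>u - u'\<bar>" for u u' by (auto simp: k_def)
  show thesis
  proof (rule that[of \<eta> q M "M / \<eta>" "\<beta> + 2 * \<eta>"])
    show "0 \<le> q z \<and> q z \<le> M" for z using M k by (auto simp: q_def mult_left_le)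
    show "\<bar>q z - q z'\<bar> \<le> M / \<eta> * \<bar>z - z'\<bar>" for z z'
    proof -
      have "\<bar>q z - q z'\<bar> = M * \<bar>k ((\<beta> + 2 * \<eta> - z) / \<eta>) - k ((\<beta> + 2 * \<eta> - z') / \<eta>)\<bar>"
        using M by (simp add: q_def abs_mult flip: right_diff_distrib)
      also have "\<dots> \<le> M * \<bar>(\<beta> + 2 * \<eta> - z) / \<eta> - (\<beta> + 2 * \<eta> - z') / \<eta>\<bar>"
        using M k by (intro mult_left_mono) auto
      also have "(\<beta> + 2 * \<eta> - z) / \<eta> - (\<beta> + 2 * \<eta> - z') / \<eta> = (z' - z) / \<eta>"
        by (simp flip: diff_divide_distrib)
      finally show ?thesis using \<eta> by (simp add: abs_minus_commute)
    qed
    show "q z = 0" if "z \<ge> \<beta> + 2 * \<eta>" for z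
      using that \<eta> by (simp add: q_def k_def divide_nonpos_pos)
    show "q z * (\<bar>Im s\<bar> - \<bar>z\<^sup>2 / (4 * R) - R\<bar>) + z + Re s \<ge> \<eta>" if z: "z \<ge> 0" for z
    proof -
      \<comment> \<open>On the plateau M c compensates Re s; on the slope the q-term is nonnegative
        and z + Re s already exceeds \<open>\<eta>\<close>; beyond it q vanishes.\<close>
      consider "z \<le> \<beta> + \<eta>" | "\<beta> + \<eta> < z" "z \<le> \<beta> + 2 * \<eta>" | "z > \<beta> + 2 * \<eta>" by linarith
      then show ?thesis
      proof cases
        case 1
        then have "q z = M" using \<eta> by (simp add: q_def k_def field_simps)
        moreover have "M * (b - \<bar>z\<^sup>2 / (4 * R) - R\<bar>) \<ge> M * c" using M sym[of z] 1 z \<eta> by (intro mult_left_mono) auto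
        moreover have "M * c = \<beta> + \<eta>" using c by (simp add: M_def)
        ultimately show ?thesis using z by (simp add: \<beta>_def b_def)
      next
        case 2
        have "q z * (b - \<bar>z\<^sup>2 / (4 * R) - R\<bar>) \<ge> 0"
          using M k(1) sym[of z] c 2 z unfolding q_def by (intro mult_nonneg_nonneg) auto
        then show ?thesis using 2 by (simp add: \<beta>_def b_def)
      next
        case 3
        then have "q z = 0" using \<eta> by (simp add: q_def k_def divide_nonpos_pos)
        then show ?thesis using 3 \<eta> by (simp add: \<beta>_def)
      qed
    qed
  qed (use \<eta> \<beta> in auto)
qed

section \<open>Energies as a measure of Gevrey regularity\<close>

context singular_ode begin

text \<open>An L2 form of Gevrey regularity of order 2: bounded instead of summable weighted
  energies, a difference that any decrease of the rate makes up for.\<close>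

definition energy_bounded :: "real \<Rightarrow> bool" where
  "energy_bounded \<tau> \<longleftrightarrow> (\<exists>B. \<forall>n. energy (\<lambda>_. \<tau>) n \<le> B)"

lemma energy_eq: "energy \<rho> n = (wt \<rho> n)\<^sup>2 * integral {0..1} (\<lambda>x. (cmod (U n x))\<^sup>2)"
  by (simp add: energy_def A_def norm_mult power_mult_distrib)

lemma energy_nonneg: "energy \<rho> n \<ge> 0"
  unfolding energy_def by (intro integral_nonneg integrable_continuous_real continuous_intros) auto

lemma energy_mono:
  assumes "\<And>i. 0 \<le> \<rho> i \<and> \<rho> i \<le> \<rho>' i"
  shows "energy \<rho> n \<le> energy \<rho>' n"
  unfolding energy_def
proof (intro integral_le integrable_continuous_real continuous_intros power_mono)
  show "cmod (A \<rho> n x) \<le> cmod (A \<rho>' n x)" for x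
    using wt_mono[of \<rho> \<rho>' n] wt_nonneg[of \<rho> n] assms
    by (auto simp: A_def norm_mult intro!: mult_right_mono)
qed auto

text \<open>Past the switch the weights equal those of rate \<open>\<tau>\<close> up to a constant
  and the factor (r/\<open>\<tau>\<close>)^n. In the gain argument this is where prior regularity
  enters.\<close>

lemma energy_eventually_constant_rate:
  assumes tail: "\<And>i. i > N \<Longrightarrow> \<rho> i = r" and r: "0 < r" "r < \<tau>" and bdd: "energy_bounded \<tau>"
  shows "energy \<rho> \<longlonglongrightarrow> 0"
proof -
  have wpos: "wt (\<lambda>_. \<tau>) n > 0" for n using r by (auto simp: wt_def)
  have "\<exists>c. \<forall>n\<ge>Suc N. wt \<rho> n = c * (r / \<tau>) ^ n * wt (\<lambda>_. \<tau>) n"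
  proof (intro exI allI impI)
    fix n assume "Suc N \<le> n"
    \<comment> \<open>The constant is the one that makes the formula exact at n = N + 1.\<close>
    then show "wt \<rho> n = (wt \<rho> (Suc N) / ((r / \<tau>) ^ Suc N * wt (\<lambda>_. \<tau>) (Suc N))) * (r / \<tau>) ^ n * wt (\<lambda>_. \<tau>) n"
    proof (induction n rule: dec_induct)
      case base
      then show ?case using wpos[of "Suc N"] r by simp
    next
      case (step n)
      then have n: "n \<ge> 1" "n > N" by auto
      show ?case unfolding wt_Suc[OF n(1), of \<rho>] wt_Suc[OF n(1), of "\<lambda>_. \<tau>"] step.IH tail[OF n(2)]
        using r by (simp add: divide_simps)
    qed
  qed
  then obtain c where c: "\<And>n. n \<ge> Suc N \<Longrightarrow> wt \<rho> n = c * (r / \<tau>) ^ n * wt (\<lambda>_. \<tau>) n" by blast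
  obtain B where B: "\<And>n. energy (\<lambda>_. \<tau>) n \<le> B" using bdd by (auto simp: energy_bounded_def)
  have "(\<lambda>n. c\<^sup>2 * ((r / \<tau>)\<^sup>2) ^ n * B) \<longlonglongrightarrow> c\<^sup>2 * 0 * B"
    using r by (intro tendsto_intros LIMSEQ_realpow_zero) (auto simp: abs_square_less_1)
  moreover have "\<forall>\<^sub>F n in sequentially. norm (energy \<rho> n) \<le> c\<^sup>2 * ((r / \<tau>)\<^sup>2) ^ n * B"
  proof (rule eventually_sequentiallyI[of "Suc N"])
    fix n assume n: "Suc N \<le> n"
    have "energy \<rho> n = c\<^sup>2 * ((r / \<tau>)\<^sup>2) ^ n * energy (\<lambda>_. \<tau>) n"
      unfolding energy_eq c[OF n] by (simp add: power_mult_distrib power_commutes flip: power_mult) (simp add: mult.commute)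
    also have "\<dots> \<le> c\<^sup>2 * ((r / \<tau>)\<^sup>2) ^ n * B" using B by (intro mult_left_mono) auto
    finally show "norm (energy \<rho> n) \<le> c\<^sup>2 * ((r / \<tau>)\<^sup>2) ^ n * B" using energy_nonneg by simp
  qed
  ultimately show ?thesis by (intro Lim_null_comparison[of "energy \<rho>"]) auto
qed

end

section \<open>Gain of Gevrey regularity\<close>

context singular_ode begin

text \<open>The number \<open>\<delta>\<close> is fixed before \<open>\<tau>\<close>, so regularity
  at any single rate above R - \<open>\<delta>\<close> suffices; the supremum argument relies on
  this order of quantifiers.\<close>

lemma energy_gain:
  assumes R: "0 < R" "R < S" and adm: "admissible s R"
  obtains \<delta> where "\<delta> > 0" "\<And>\<tau>. R - \<delta> < \<tau> \<Longrightarrow> energy_bounded \<tau> \<Longrightarrow> energy_bounded (R + \<delta>)"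
proof -
  obtain q :: "real \<Rightarrow> real" and M L Z \<kappa> where \<kappa>0: "\<kappa> > 0" and q: "\<And>z. 0 \<le> q z \<and> q z \<le> M"
    and L: "\<And>z z'. \<bar>q z - q z'\<bar> \<le> L * \<bar>z - z'\<bar>" and Z: "Z \<ge> 0" "\<And>z. z \<ge> Z \<Longrightarrow> q z = 0"
    and \<kappa>: "\<And>z. z \<ge> 0 \<Longrightarrow> q z * (\<bar>Im s\<bar> - \<bar>z\<^sup>2 / (4 * R) - R\<bar>) + z + Re s \<ge> \<kappa>"
    using cutoff_exists[OF R(1) adm] by metis
  obtain K where K: "K \<ge> 0" and cutoff: "\<And>n x r c. n \<ge> 1 \<Longrightarrow> x \<in> {0..1} \<Longrightarrow> \<bar>r - R\<bar> \<le> R / 2 \<Longrightarrow>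
      c = q ((2 * real n - 1) * x) * (x\<^sup>2 * real n * (real n + 1) / r) - q ((2 * real n + 1) * x) * r \<Longrightarrow>
      \<bar>c\<bar> \<le> q ((2 * real n - 1) * x) * \<bar>((2 * real n - 1) * x)\<^sup>2 / (4 * R) - R\<bar> + K * (\<bar>r - R\<bar> + 1 / real n) \<and>
      \<bar>c\<bar> \<le> q ((2 * real n + 1) * x) * \<bar>((2 * real n + 1) * x)\<^sup>2 / (4 * R) - R\<bar> + K * (\<bar>r - R\<bar> + 1 / real n)"
  proof (rule cutoff_coeff_bound[of R q M L Z], goal_cases)
    case (6 K)
    show ?case by (rule that) (fact 6)+
  qed (use R q L Z in auto)
  \<comment> \<open>A rate strictly between R and both S and |s|: the bounds on F and on the values
    at 0 hold for \<open>R1\<close> and thereby uniformly for all rates used below.\<close>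
  define R1 where "R1 = (R + min S (cmod s)) / 2"
  have R1: "R < R1" "R1 < S" "R1 < cmod s" "R1 > 0"
    using R adm by (auto simp: R1_def admissible_def)
  obtain D where D: "D \<ge> 0" and F: "\<And>\<rho> n x. (\<And>i. 0 \<le> \<rho> i \<and> \<rho> i \<le> R1) \<Longrightarrow> n \<ge> 1 \<Longrightarrow> x \<in> {0..1} \<Longrightarrow>
     cmod (F \<rho> n x) \<le> D / (real n * real (n + 1)) * (\<Sum>m\<le>n. cmod (A \<rho> m x))"
    using F_bound[OF R1(4,2)] by metis
  obtain B where B: "\<And>n. cmod (A (\<lambda>_. R1) n 0) \<le> B" using A_at_0_bounded[OF R1(4,2,3)] by metis
  have B0: "B \<ge> 0" using B[of 0] norm_ge_zero order_trans by blast
  \<comment> \<open>The three bounds keep R + \<open>\<delta>\<close> below \<open>R1\<close>, keep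
    all rates within R/2 of R as the cutoff estimate demands, and make K \<open>\<delta>\<close> at
    most \<open>\<kappa>\<close>/8.\<close>
  define \<delta> where "\<delta> = min (R1 - R) (min (R / 2) (\<kappa> / (8 * (K + 1))))"
  have \<delta>: "\<delta> > 0" "\<delta> \<le> R1 - R" "\<delta> \<le> R / 2" "\<delta> \<le> \<kappa> / (8 * (K + 1))"
  proof -
    have "\<kappa> / (8 * (K + 1)) > 0" using \<kappa>0 K by simp
    then show "\<delta> > 0" "\<delta> \<le> R1 - R" "\<delta> \<le> R / 2" "\<delta> \<le> \<kappa> / (8 * (K + 1))"
      using R R1 unfolding \<delta>_def by linarith+
  qed
  have M: "M \<ge> 0" using q[of 0] by simp
  \<comment> \<open>Gives K/n at most \<open>\<kappa>\<close>/8 for n past \<open>n0\<close>, and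
    (1+M) D/(2 n0) at most \<open>\<kappa>\<close>/8. With the choice of \<open>\<delta>\<close>,
    the losses add up to half of \<open>\<kappa> * Sm\<close>.\<close>
  obtain n0 :: nat where n0: "n0 \<ge> 1" "real n0 \<ge> 8 * K / \<kappa>" "real n0 \<ge> 4 * (1 + M) * D / \<kappa>"
    using real_arch_simple[of "Max {1, 8 * K / \<kappa>, 4 * (1 + M) * D / \<kappa>}"] by auto
  \<comment> \<open>Majorises the initial energies for all rates up to \<open>R1\<close>, hence
    independently of the switching index N.\<close>
  define T where "T = (\<Sum>m\<le>Suc n0. energy (\<lambda>_. R1) m)"
  define G where "G = 2 * M * R + 2 * M * Z\<^sup>2 / R"
  have G: "G \<ge> 0" using M R by (simp add: G_def)
  define Kf where "Kf = 2 / \<kappa> * (\<kappa> / 8 * T + R1\<^sup>2 * B\<^sup>2 + G * (2 * T + 1))"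
  have "energy_bounded (R + \<delta>)" if \<tau>: "R - \<delta> < \<tau>" "energy_bounded \<tau>" for \<tau>
  proof -
    have main: "energy (\<lambda>_. R + \<delta>) (Suc N) \<le> Kf" if N: "N \<ge> n0" for N
    proof -
      \<comment> \<open>The higher rate up to N carries the desired information; the lower one
        afterwards lies below \<open>\<tau>\<close> and forces the tail to vanish.\<close>
      define \<rho> where "\<rho> i = (if i \<le> N then R + \<delta> else R - \<delta>)" for i
      have \<rho>R: "\<bar>\<rho> i - R\<bar> \<le> \<delta>" for i using \<delta> by (simp add: \<rho>_def)
      have \<rho>1: "0 \<le> \<rho> i \<and> \<rho> i \<le> R1" for i using \<delta> R R1 by (auto simp: \<rho>_def)
      define E where "E = energy \<rho>"
      have E0: "E n \<ge> 0" for n by (simp add: E_def energy_nonneg)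
      have ET: "E n \<le> energy (\<lambda>_. R1) n" for n unfolding E_def using \<rho>1 by (intro energy_mono) auto
      have T1: "(\<Sum>m\<le>n0. E m) \<le> T"
        unfolding T_def using ET energy_nonneg order_trans[OF E0 ET] by (intro order_trans[OF sum_mono[OF ET] sum_mono2]) auto
      have T2: "E n0 + E (Suc n0) \<le> 2 * T"
      proof -
        have "energy (\<lambda>_. R1) n0 \<le> T" "energy (\<lambda>_. R1) (Suc n0) \<le> T"
          unfolding T_def by (intro member_le_sum energy_nonneg; simp)+
        then show ?thesis using ET[of n0] ET[of "Suc n0"] by linarith
      qed
      have lim: "E \<longlonglongrightarrow> 0" unfolding E_def
        by (rule energy_eventually_constant_rate[where N=N and r="R - \<delta>" and \<tau>=\<tau>]) (use \<delta> R \<tau> in \<open>auto simp: \<rho>_def\<close>)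
      then have "\<forall>\<^sub>F n in sequentially. E n < 1 / 2" by (rule order_tendstoD) simp
      then obtain P0 where P0: "\<And>n. n \<ge> P0 \<Longrightarrow> E n < 1 / 2" by (auto simp: eventually_sequentially)
      \<comment> \<open>Past \<open>P0\<close> the two end energies are below 1/2, contributing the
        1 in \<open>Kf\<close>; P at least N keeps \<open>E (Suc N)\<close> inside the sum.\<close>
      define P where "P = max P0 N"
      define Sm where "Sm = (\<Sum>n=n0..P. E (Suc n))"
      have Sm0: "Sm \<ge> 0" unfolding Sm_def by (intro sum_nonneg E0)
      have "\<kappa> * Sm \<le> (\<kappa> / 4) * Sm
        + (1 + M) * (\<Sum>n=n0..P. D / (2 * (real n * real (n + 1))) * (\<Sum>m\<le>n. E m + E (Suc n)))
        + (\<Sum>n=n0..P. (\<rho> n)\<^sup>2 / (2 * (real n * real (n + 1))) * (cmod (A \<rho> n 0))\<^sup>2)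
        + G * (E n0 + E (Suc n0) + E (Suc P) + E (Suc (Suc P)))"
        unfolding Sm_def E_def G_def
      proof (rule energy_estimate[OF R(1) q Z \<kappa> cutoff])
        show "\<bar>\<rho> i - R\<bar> \<le> R / 2" for i using \<rho>R[of i] \<delta> by linarith
        show "cmod (F \<rho> n x) \<le> D / (real n * real (n + 1)) * (\<Sum>m\<le>n. cmod (A \<rho> m x))"
          if "n \<ge> 1" "x \<in> {0..1}" for n x using F[OF \<rho>1 that] .
        show "K * (\<bar>\<rho> i - R\<bar> + 1 / real n) \<le> \<kappa> / 4" if n: "n0 \<le> n" for n i
        proof -
          have "K * \<bar>\<rho> i - R\<bar> \<le> (K + 1) * (\<kappa> / (8 * (K + 1)))"
            using K \<rho>R[of i] \<delta> by (intro mult_mono) auto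
          also have "\<dots> = \<kappa> / 8" using K by (simp add: field_simps)
          finally have 1: "K * \<bar>\<rho> i - R\<bar> \<le> \<kappa> / 8" .
          have "real n \<ge> 8 * K / \<kappa>" "real n > 0" using n n0 by auto
          then have "K * (1 / real n) \<le> \<kappa> / 8" using \<kappa>0 by (simp add: field_simps)
          then show ?thesis using 1 unfolding distrib_left by linarith
        qed
      qed (use D \<kappa>0 n0 N in \<open>auto simp: P_def\<close>)
      moreover have "(1 + M) * (\<Sum>n=n0..P. D / (2 * (real n * real (n + 1))) * (\<Sum>m\<le>n. E m + E (Suc n))) \<le> \<kappa> / 8 * (T + 2 * Sm)"
      proof -
        have "(1 + M) * (\<Sum>n=n0..P. D / (2 * (real n * real (n + 1))) * (\<Sum>m\<le>n. E m + E (Suc n)))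
          \<le> (1 + M) * (D / (2 * real n0) * ((\<Sum>m\<le>n0. E m) + 2 * Sm))"
          unfolding Sm_def using M E0 D n0 by (intro mult_left_mono convolution_sum_le) auto
        also have "\<dots> = ((1 + M) * D / (2 * real n0)) * ((\<Sum>m\<le>n0. E m) + 2 * Sm)" by simp
        also have "\<dots> \<le> (\<kappa> / 8) * (T + 2 * Sm)"
        proof (intro mult_mono add_right_mono T1)
          show "(1 + M) * D / (2 * real n0) \<le> \<kappa> / 8" using n0 \<kappa>0 by (simp add: field_simps)
        qed (use \<kappa>0 Sm0 E0 in \<open>auto intro!: add_nonneg_nonneg sum_nonneg\<close>)
        finally show ?thesis .
      qed
      moreover have "(\<Sum>n=n0..P. (\<rho> n)\<^sup>2 / (2 * (real n * real (n + 1))) * (cmod (A \<rho> n 0))\<^sup>2) \<le> R1\<^sup>2 * B\<^sup>2"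
      proof -
        have AB: "cmod (A \<rho> n 0) \<le> B" for n
        proof -
          have "cmod (A \<rho> n 0) \<le> cmod (A (\<lambda>_. R1) n 0)"
            using wt_mono[of \<rho> "\<lambda>_. R1" n] wt_nonneg[of \<rho> n] \<rho>1
            by (auto simp: A_def norm_mult intro!: mult_right_mono)
          then show ?thesis using B[of n] by linarith
        qed
        have "(\<Sum>n=n0..P. (\<rho> n)\<^sup>2 / (2 * (real n * real (n + 1))) * (cmod (A \<rho> n 0))\<^sup>2) \<le>
          (\<Sum>n=n0..P. R1\<^sup>2 / (2 * (real n * real (n + 1))) * B\<^sup>2)"
          using \<rho>1 AB by (intro sum_mono mult_mono divide_right_mono power_mono) auto
        also have "\<dots> = R1\<^sup>2 * B\<^sup>2 / 2 * (\<Sum>n=n0..P. 1 / (real n * real (n + 1)))"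
          by (simp add: sum_distrib_left mult.commute)
        also have "\<dots> \<le> R1\<^sup>2 * B\<^sup>2 / 2 * (1 / real n0)"
          using n0 by (intro mult_left_mono sum_inverse_consecutive_le) auto
        also have "\<dots> \<le> R1\<^sup>2 * B\<^sup>2 / 2 * 1" using n0 by (intro mult_left_mono) auto
        also have "\<dots> \<le> R1\<^sup>2 * B\<^sup>2" by simp
        finally show ?thesis .
      qed
      moreover have "G * (E n0 + E (Suc n0) + E (Suc P) + E (Suc (Suc P))) \<le> G * (2 * T + 1)"
      proof (intro mult_left_mono G)
        have "E (Suc P) < 1 / 2" "E (Suc (Suc P)) < 1 / 2" by (rule P0, simp add: P_def)+
        then show "E n0 + E (Suc n0) + E (Suc P) + E (Suc (Suc P)) \<le> 2 * T + 1" using T2 by linarith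
      qed
      ultimately have "\<kappa> * Sm \<le> \<kappa> / 2 * Sm + \<kappa> / 8 * T + R1\<^sup>2 * B\<^sup>2 + G * (2 * T + 1)"
        by (simp add: algebra_simps)
      then have "Sm \<le> Kf" unfolding Kf_def using \<kappa>0 by (simp add: field_simps)
      moreover have "E (Suc N) \<le> Sm" unfolding Sm_def using N by (intro member_le_sum E0) (auto simp: P_def)
      \<comment> \<open>The weight at N + 1 involves only the rates with index at most N, so it does
        not see the switch.\<close>
      moreover have "E (Suc N) = energy (\<lambda>_. R + \<delta>) (Suc N)"
      proof -
        have "wt \<rho> (Suc N) = wt (\<lambda>_. R + \<delta>) (Suc N)"
          unfolding wt_def by (auto simp: \<rho>_def simp del: prod.op_ivl_Suc prod_constant intro!: prod.cong)
        then show ?thesis by (simp add: E_def energy_eq)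
      qed
      ultimately show ?thesis by simp
    qed
    show ?thesis unfolding energy_bounded_def
    proof (intro exI allI)
      fix n
      show "energy (\<lambda>_. R + \<delta>) n \<le> max Kf (\<Sum>m\<le>n0. energy (\<lambda>_. R + \<delta>) m)"
      proof (cases "n \<le> n0")
        case True
        then have "energy (\<lambda>_. R + \<delta>) n \<le> (\<Sum>m\<le>n0. energy (\<lambda>_. R + \<delta>) m)"
          by (intro member_le_sum energy_nonneg) auto
        then show ?thesis by simp
      next
        case False
        then obtain N where "n = Suc N" "N \<ge> n0" by (cases n) auto
        then show ?thesis using main[of N] by simp
      qed
    qed
  qed
  then show thesis using that[OF \<delta>(1)] by blast
qed

lemma energy_bounded_mono:
  assumes "energy_bounded \<tau>" "0 \<le> r" "r \<le> \<tau>"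
  shows "energy_bounded r"
proof -
  obtain B where "\<And>n. energy (\<lambda>_. \<tau>) n \<le> B" using assms by (auto simp: energy_bounded_def)
  moreover have "energy (\<lambda>_. r) n \<le> energy (\<lambda>_. \<tau>) n" for n using assms by (intro energy_mono) auto
  ultimately show ?thesis unfolding energy_bounded_def by (meson order_trans)
qed

text \<open>If no rate beyond \<open>\<sigma>'\<close> were reached, the supremum of the attained
  rates would be admissible and the gain there would exceed it. The supremum itself need not be
  attained; an attained rate just below it is enough.\<close>

lemma energy_bounded_propagates:
  assumes \<sigma>: "0 < \<sigma>" "\<sigma> \<le> \<sigma>'" "\<sigma>' < S" and adm: "\<And>R. \<sigma> \<le> R \<Longrightarrow> R \<le> \<sigma>' \<Longrightarrow> admissible s R"
    and bdd: "energy_bounded \<sigma>"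
  obtains \<tau> where "\<tau> > \<sigma>'" "energy_bounded \<tau>"
proof (rule ccontr)
  note obt = that
  assume no: "\<not> thesis"
  define X where "X = {\<tau>. \<sigma> \<le> \<tau> \<and> energy_bounded \<tau>}"
  have X\<sigma>: "\<sigma> \<in> X" using bdd by (simp add: X_def)
  have Xle: "\<tau> \<le> \<sigma>'" if "\<tau> \<in> X" for \<tau>
    using no obt[of \<tau>] that by (auto simp: X_def not_le[symmetric])
  have bX: "bdd_above X" using Xle by (intro bdd_aboveI) auto
  define R where "R = Sup X"
  have R: "\<sigma> \<le> R" "R \<le> \<sigma>'" unfolding R_def using X\<sigma> bX Xle by (auto intro!: cSup_upper cSup_least)
  have "0 < R" "R < S" using R \<sigma> by auto
  then obtain \<delta> where \<delta>: "\<delta> > 0" "\<And>\<tau>. R - \<delta> < \<tau> \<Longrightarrow> energy_bounded \<tau> \<Longrightarrow> energy_bounded (R + \<delta>)"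
    using energy_gain[OF _ _ adm[OF R]] by metis
  obtain \<tau> where "\<tau> \<in> X" "R - \<delta> < \<tau>"
    using less_cSup_iff[of X "R - \<delta>"] X\<sigma> bX \<delta>(1) unfolding R_def by auto
  then have "R + \<delta> \<in> X" using \<delta> R by (auto simp: X_def)
  then have "R + \<delta> \<le> R" unfolding R_def by (intro cSup_upper bX)
  then show False using \<delta> by simp
qed

end

section \<open>Regularity of kernel elements\<close>

text \<open>Each factor n is absorbed by part of the decay: q = p p with p = sqrt q, and n p^n is
  bounded.\<close>

lemma summable_power_times_geometric:
  fixes q :: real
  assumes "0 \<le> q" "q < 1"
  shows "summable (\<lambda>n. real n ^ k * q ^ n)"
  using assms
proof (induction k arbitrary: q)
  case 0
  then show ?case by (simp add: summable_geometric)
next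
  case (Suc k)
  define p where "p = sqrt q"
  have p: "0 \<le> p" "p < 1" "q = p * p" using Suc.prems by (auto simp: p_def)
  obtain B where B: "\<And>n. real n * p ^ n \<le> B" using times_power_bounded[OF p(1,2)] by blast
  show ?case
  proof (rule summable_comparison_test')
    show "summable (\<lambda>n. B * (real n ^ k * p ^ n))" by (intro summable_mult Suc.IH p)
    fix n
    have "real n ^ Suc k * q ^ n = (real n * p ^ n) * (real n ^ k * p ^ n)"
      by (simp add: p(3) power_mult_distrib)
    also have "\<dots> \<le> B * (real n ^ k * p ^ n)" using B p by (intro mult_right_mono) auto
    finally show "norm (real n ^ Suc k * q ^ n) \<le> B * (real n ^ k * p ^ n)"
      using Suc.prems by (simp add: abs_mult)
  qed
qed

lemma dn_cont: "smooth_I u \<Longrightarrow> continuous_on {0..1} (dn n u)"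
  using derivs_family_dn[of u] unfolding derivs_family_def
  by (intro continuous_on_vector_derivative[of _ _ "dn (Suc n) u"]) auto

text \<open>The definition bounds derivatives on the open interval only; continuity extends the
  bound to the endpoints, where the recurrence at 0 uses it.\<close>

lemma gevrey_bound:
  assumes "gevrey \<sigma> 2 W" "\<sigma> > 0"
  obtains C where "\<And>n x. x \<in> {0..1} \<Longrightarrow> cmod (dn n W x) \<le> C * (fact n)\<^sup>2 / \<sigma> ^ n"
proof -
  obtain C where W: "smooth_I W"
    and C: "\<And>n x. x \<in> {0<..<1} \<Longrightarrow> norm (dn n W x) \<le> C * \<sigma> powr (- real n) * fact n powr 2"
    using assms unfolding gevrey_def by blast
  have "cmod (dn n W x) \<le> C * (fact n)\<^sup>2 / \<sigma> ^ n" if x: "x \<in> {0..1}" for n x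
  proof (rule continuous_le_on_closure[of "{0<..<1}" "\<lambda>x. cmod (dn n W x)"])
    show "continuous_on (closure {0<..<1}) (\<lambda>x. cmod (dn n W x))"
      using dn_cont[OF W] by (auto intro!: continuous_intros)
    show "x \<in> closure {0<..<1}" using x by simp
    fix y :: real assume "y \<in> {0<..<1}"
    then show "cmod (dn n W y) \<le> C * (fact n)\<^sup>2 / \<sigma> ^ n"
      using C[of y n] assms(2) by (simp add: powr_minus powr_realpow divide_inverse mult_ac)
  qed
  then show thesis by (rule that)
qed

text \<open>The strict gap between \<open>\<sigma>\<close> and \<open>\<tau>\<close> supplies the
  geometric factor (\<open>\<sigma>\<close>/\<open>\<tau>\<close>)^(2n), which outweighs n^k in all
  seminorms at once.\<close>

lemma Xsp_of_bounds:
  assumes u: "u \<in> Cinf" "u 1 = 0" and \<sigma>: "0 < \<sigma>" "\<sigma> < \<tau>"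
    and B: "\<And>n. (\<tau> ^ n / (fact n * fact (Suc n)))\<^sup>2 * integral {0..1} (\<lambda>x. (cmod (dn (Suc n) u x))\<^sup>2) \<le> B"
    and B0: "\<And>n. \<tau> ^ n / (fact n * fact (Suc n)) * cmod (dn (Suc n) u 0) \<le> B'"
  shows "u \<in> Xsp \<sigma>"
proof -
  have su: "smooth_I u" using u by (simp add: Cinf_def)
  define q where "q = (\<sigma> / \<tau>)\<^sup>2"
  have q: "0 \<le> q" "q < 1" using \<sigma> by (auto simp: q_def abs_square_less_1)
  have scale: "\<sigma> ^ (2 * n) / ((fact n)\<^sup>2 * (fact (n + 1))\<^sup>2) = q ^ n * (\<tau> ^ n / (fact n * fact (Suc n)))\<^sup>2" for n
    using \<sigma> by (simp add: q_def power_divide power_mult_distrib power_even_eq flip: power_mult)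
  have I0: "integral {0..1} (\<lambda>x. (cmod (dn n u x))\<^sup>2) \<ge> 0" for n
    by (intro integral_nonneg integrable_continuous_real continuous_intros dn_cont su) auto
  have "seminorm_fin \<sigma> k (dx u)" for k
    unfolding seminorm_fin_def
  proof (rule summable_comparison_test')
    show "summable (\<lambda>n. B / \<sigma> ^ k * (real n ^ k * q ^ n))"
      by (intro summable_mult summable_power_times_geometric q)
    fix n
    define J where "J = integral {0..1} (\<lambda>x. (x / \<sigma>) ^ k * (norm (dn n (dx u) x))\<^sup>2)"
    have J: "J = integral {0..1} (\<lambda>x. (x / \<sigma>) ^ k * (norm (dn (Suc n) u x))\<^sup>2)"
      unfolding J_def by (intro integral_cong) (simp add: dn_dx[OF su])
    have J0: "J \<ge> 0" unfolding J using \<sigma>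
      by (intro integral_nonneg integrable_continuous_real continuous_intros dn_cont su) auto
    have "J \<le> integral {0..1} (\<lambda>x. (1 / \<sigma> ^ k) * (norm (dn (Suc n) u x))\<^sup>2)"
      unfolding J
    proof (intro integral_le integrable_continuous_real continuous_intros dn_cont su mult_right_mono)
      fix x :: real assume "x \<in> {0..1}"
      then show "(x / \<sigma>) ^ k \<le> 1 / \<sigma> ^ k"
        using \<sigma> by (auto simp: power_divide intro!: divide_right_mono power_le_one)
    qed (use \<sigma> in auto)
    also have "\<dots> = (1 / \<sigma> ^ k) * integral {0..1} (\<lambda>x. (norm (dn (Suc n) u x))\<^sup>2)" by simp
    finally have J1: "J \<le> (1 / \<sigma> ^ k) * integral {0..1} (\<lambda>x. (norm (dn (Suc n) u x))\<^sup>2)" .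
    have "seminorm_term \<sigma> k (dx u) n = q ^ n * real n ^ k * ((\<tau> ^ n / (fact n * fact (Suc n)))\<^sup>2 * J)"
      unfolding seminorm_term_def scale J_def by simp
    also have "\<dots> \<le> q ^ n * real n ^ k * ((\<tau> ^ n / (fact n * fact (Suc n)))\<^sup>2 *
         ((1 / \<sigma> ^ k) * integral {0..1} (\<lambda>x. (norm (dn (Suc n) u x))\<^sup>2)))"
      using J1 q by (intro mult_left_mono) auto
    also have "\<dots> = q ^ n * real n ^ k * (1 / \<sigma> ^ k) * ((\<tau> ^ n / (fact n * fact (Suc n)))\<^sup>2 *
         integral {0..1} (\<lambda>x. (norm (dn (Suc n) u x))\<^sup>2))" by simp
    also have "\<dots> \<le> q ^ n * real n ^ k * (1 / \<sigma> ^ k) * B"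
      using B q \<sigma> by (intro mult_left_mono) auto
    finally have "seminorm_term \<sigma> k (dx u) n \<le> B / \<sigma> ^ k * (real n ^ k * q ^ n)" by (simp add: mult_ac)
    moreover have "seminorm_term \<sigma> k (dx u) n \<ge> 0"
      unfolding seminorm_term_def scale J_def[symmetric] using q J0 by auto
    ultimately show "norm (seminorm_term \<sigma> k (dx u) n) \<le> B / \<sigma> ^ k * (real n ^ k * q ^ n)" by simp
  qed
  moreover have "bdry_fin \<sigma> (dx u)"
    unfolding bdry_fin_def
  proof (rule summable_comparison_test')
    show "summable (\<lambda>n. \<sigma> * B'\<^sup>2 * q ^ n)"
      using q by (intro summable_mult summable_geometric) auto
    fix n
    have "bdry_term \<sigma> (dx u) n = \<sigma> * (\<sigma> ^ (2 * n) / ((fact n)\<^sup>2 * (fact (n + 1))\<^sup>2)) * (cmod (dn (Suc n) u 0))\<^sup>2"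
      unfolding bdry_term_def using dn_dx[OF su, of 0 n] by simp
    also have "\<dots> = \<sigma> * q ^ n * (\<tau> ^ n / (fact n * fact (Suc n)) * cmod (dn (Suc n) u 0))\<^sup>2"
      unfolding scale power_mult_distrib by (simp only: mult.assoc)
    finally have e: "bdry_term \<sigma> (dx u) n = \<sigma> * q ^ n * (\<tau> ^ n / (fact n * fact (Suc n)) * cmod (dn (Suc n) u 0))\<^sup>2" .
    have "\<dots> \<le> \<sigma> * q ^ n * B'\<^sup>2"
      using B0[of n] q \<sigma> by (intro mult_left_mono power_mono) auto
    then have "bdry_term \<sigma> (dx u) n \<le> \<sigma> * B'\<^sup>2 * q ^ n" unfolding e by (simp add: mult_ac)
    moreover have "bdry_term \<sigma> (dx u) n \<ge> 0" unfolding e using q \<sigma> by simp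
    ultimately show "norm (bdry_term \<sigma> (dx u) n) \<le> \<sigma> * B'\<^sup>2 * q ^ n" by simp
  qed
  ultimately show ?thesis using u by (simp add: Xsp_def)
qed

text \<open>The two rates are not ordered, so the same statement yields both inclusions between the
  kernels.\<close>

lemma kernel_regularity:
  assumes W: "gevrey \<sigma>s 2 W" and \<sigma>: "0 < \<sigma>1" "0 < \<sigma>2" "\<sigma>1 < \<sigma>s" "\<sigma>2 < \<sigma>s"
    and adm: "\<And>R. min \<sigma>1 \<sigma>2 \<le> R \<Longrightarrow> R \<le> max \<sigma>1 \<sigma>2 \<Longrightarrow> admissible s R"
    and u: "u \<in> Xsp \<sigma>1" and ker: "Lop W s u = (\<lambda>x. 0)"
  shows "u \<in> Xsp \<sigma>2"
proof -
  have uC: "u \<in> Cinf" and u1: "u 1 = 0" and X0: "seminorm_fin \<sigma>1 0 (dx u)" using u by (auto simp: Xsp_def)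
  have su: "smooth_I u" using uC by (simp add: Cinf_def)
  have sW: "smooth_I W" using W by (simp add: gevrey_def)
  have \<sigma>s: "\<sigma>s > 0" using \<sigma> by simp
  obtain C where C: "\<And>n x. x \<in> {0..1} \<Longrightarrow> cmod (dn n W x) \<le> C * (fact n)\<^sup>2 / \<sigma>s ^ n"
    using gevrey_bound[OF W \<sigma>s] by blast
  interpret singular_ode "\<lambda>n. dn n u" "\<lambda>n. dn n W" s \<sigma>s C
  proof
    show "(dn n u has_vector_derivative dn (Suc n) u x) (at x within {0..1})" if "x \<in> {0..1}" for n x
      using derivs_family_dn[OF su] that by (auto simp: derivs_family_def)
    show "cmod (dn n W x) \<le> C * (fact n)\<^sup>2 / \<sigma>s ^ n" if "x \<in> {0..1}" for n x using C that .
  qed (rule kernel_ode[OF su sW ker])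
  have "energy_bounded \<sigma>1"
  proof -
    \<comment> \<open>The index shift reflects that the norms are those of u'; the energy at index 0
      lies outside them and enters through the \<open>max\<close> below.\<close>
    have e: "energy (\<lambda>_. \<sigma>1) (Suc n) = seminorm_term \<sigma>1 0 (dx u) n" for n
    proof -
      have "integral {0..1} (\<lambda>x. (cmod (dn (Suc n) u x))\<^sup>2) = integral {0..1} (\<lambda>x. (x / \<sigma>1) ^ 0 * (cmod (dn n (dx u) x))\<^sup>2)"
        by (intro integral_cong) (simp add: dn_dx[OF su])
      then show ?thesis unfolding energy_eq wt_const seminorm_term_def
        by (simp add: power_divide power_mult_distrib mult.commute flip: power_mult)
    qed
    have "Bseq (seminorm_term \<sigma>1 0 (dx u))"
      using X0 unfolding seminorm_fin_def by (intro convergent_imp_Bseq convergentI[of _ 0] summable_LIMSEQ_zero)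
    then obtain K where K: "\<And>n. norm (seminorm_term \<sigma>1 0 (dx u) n) \<le> K" by (auto simp: Bseq_def)
    have "energy (\<lambda>_. \<sigma>1) n \<le> max K (energy (\<lambda>_. \<sigma>1) 0)" for n
      using e K by (cases n) (auto simp: le_max_iff_disj abs_le_iff)
    then show ?thesis unfolding energy_bounded_def by blast
  qed
  \<comment> \<open>A rate strictly above \<open>\<sigma>2\<close> is required for the geometric
    factor: it is \<open>\<sigma>1\<close> itself if larger, and otherwise comes from
    propagation.\<close>
  obtain \<tau>1 where \<tau>1: "\<tau>1 > \<sigma>2" "energy_bounded \<tau>1"
  proof (cases "\<sigma>2 < \<sigma>1")
    case True
    then show thesis using that \<open>energy_bounded \<sigma>1\<close> by blast
  next
    case False
    then show thesis
      using energy_bounded_propagates[of \<sigma>1 \<sigma>2] \<sigma> adm \<open>energy_bounded \<sigma>1\<close> that by (auto simp: min_def max_def split: if_splits)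
  qed
  \<comment> \<open>Room is left below both the Gevrey rate of W and |s|, so one rate can serve the
    energies and the recurrence at the origin.\<close>
  have "\<sigma>2 < min \<sigma>s (cmod s)" using adm[of \<sigma>2] \<sigma> by (simp add: admissible_def)
  then obtain \<tau>2 where \<tau>2: "\<sigma>2 < \<tau>2" "\<tau>2 < \<sigma>s" "\<tau>2 < cmod s" using dense by (metis min_less_iff_conj)
  define \<tau> where "\<tau> = min \<tau>1 \<tau>2"
  have \<tau>: "\<sigma>2 < \<tau>" "\<tau> < \<sigma>s" "\<tau> < cmod s" "0 < \<tau>" using \<tau>1 \<tau>2 \<sigma> by (auto simp: \<tau>_def)
  obtain B where B: "\<And>n. energy (\<lambda>_. \<tau>) n \<le> B"
    using energy_bounded_mono[OF \<tau>1(2), of \<tau>] \<tau> by (auto simp: energy_bounded_def \<tau>_def)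
  obtain B' where B': "\<And>n. cmod (A (\<lambda>_. \<tau>) n 0) \<le> B'"
    using A_at_0_bounded[OF \<tau>(4,2,3)] by blast
  show ?thesis
  proof (rule Xsp_of_bounds[OF uC u1 \<sigma>(2) \<tau>(1)])
    show "(\<tau> ^ n / (fact n * fact (Suc n)))\<^sup>2 * integral {0..1} (\<lambda>x. (cmod (dn (Suc n) u x))\<^sup>2) \<le> B" for n
      using B[of "Suc n"] unfolding energy_eq wt_const .
    show "\<tau> ^ n / (fact n * fact (Suc n)) * cmod (dn (Suc n) u 0) \<le> B'" for n
      using B'[of "Suc n"] \<tau> abs_of_nonneg[of "\<tau> ^ n / (fact n * fact (Suc n))"]
      unfolding A_def wt_const norm_mult norm_of_real by simp
  qed
qed

section \<open>From the parameter domains to admissible rates, and equality of the kernels\<close>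

text \<open>The conditions R < |s| and R < |Im s| are inherited from the larger rate
  \<open>\<sigma>'\<close>, the quadratic one from the smaller rate \<open>\<sigma>\<close>, because
  R^2 + |Im s| R increases with R.\<close>

lemma Omega_admissible:
  assumes s: "s \<in> Omega \<sigma>" "s \<in> Omega \<sigma>'" and \<sigma>: "0 < \<sigma>" "\<sigma> \<le> R" "R \<le> \<sigma>'"
  shows "admissible s R"
proof (cases "Re s > 0")
  case True
  then show ?thesis using s \<sigma> by (auto simp: admissible_def Omega_def Omega1_def)
next
  case False
  define r where "r = cmod s"
  define c where "c = Re s"
  define b where "b = \<bar>Im s\<bar>"
  have c: "c \<le> 0" using False by (simp add: c_def)
  have b: "\<sigma>' < b" using s False by (auto simp: Omega_def Omega1_def b_def)
  have br: "b \<le> r" unfolding b_def r_def by (rule abs_Im_le_cmod)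
  have rb: "r\<^sup>2 = c\<^sup>2 + b\<^sup>2" by (simp add: r_def c_def b_def cmod_power2)
  have r: "r > 0" using b br \<sigma> by linarith
  have "c\<^sup>2 / 4 < \<sigma>\<^sup>2 + b * \<sigma>"
  proof -
    from s have "s \<in> Omega2 \<sigma> \<or> s \<in> Omega3 \<sigma>" by (auto simp: Omega_def)
    then show ?thesis
    proof
      assume "s \<in> Omega2 \<sigma>"
      then have 1: "\<sigma> < r + c" "- c * r / (2 * (r + c)) < \<sigma>" by (auto simp: Omega2_def r_def c_def)
      have "2 * (r + c) > 0" using 1 \<sigma> by simp
      from 1(2)[unfolded pos_divide_less_eq[OF this]] have "- c * r < 2 * \<sigma> * (r + c)" by (simp add: mult_ac)
      also have "\<dots> \<le> 2 * \<sigma> * r" using c \<sigma> by (intro mult_left_mono) auto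
      \<comment> \<open>Thus \<open>Omega2\<close> even gives c^2/4 < \<open>\<sigma>\<close>^2 in
        this case.\<close>
      finally have "- c < 2 * \<sigma>" using r mult_right_less_imp_less[of "- c" r "2 * \<sigma>"] by auto
      then have "(- c)\<^sup>2 < (2 * \<sigma>)\<^sup>2" using c by (intro power_strict_mono) auto
      moreover have "b * \<sigma> > 0" using b \<sigma> by (intro mult_pos_pos) auto
      ultimately show ?thesis by (simp add: power_mult_distrib)
    next
      assume "s \<in> Omega3 \<sigma>"
      then have 1: "\<sigma> * (r - \<sigma> + c) - (\<sigma> * (1 + c / r) + c / 2)\<^sup>2 > 0" by (auto simp: Omega3_def r_def c_def)
      define t where "t = 1 + c / r"
      have ct: "r * t = r + c" using r by (simp add: t_def field_simps)
      \<comment> \<open>With r t = r + c, the product t(r - c) equals b^2/r, hence is at most b. The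
        \<open>Omega3\<close> inequality rearranges so that precisely this product appears.\<close>
      have tb: "t * (r - c) \<le> b"
      proof -
        have "r * (t * (r - c)) = (r + c) * (r - c)" using ct by (simp flip: mult.assoc)
        also have "\<dots> = b * b" using rb by (simp add: power2_eq_square algebra_simps)
        also have "\<dots> \<le> r * b" using br b \<sigma> by (intro mult_right_mono) auto
        finally show ?thesis using r by (simp add: mult_le_cancel_left)
      qed
      have "c\<^sup>2 / 4 < \<sigma> * (r + c) - \<sigma>\<^sup>2 - \<sigma>\<^sup>2 * t\<^sup>2 - \<sigma> * t * c"
        using 1 unfolding t_def[symmetric] by (simp add: power2_eq_square algebra_simps)
      also have "\<dots> = \<sigma> * (t * (r - c)) - \<sigma>\<^sup>2 - \<sigma>\<^sup>2 * t\<^sup>2"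
        unfolding ct[symmetric] by (simp add: algebra_simps)
      also have "\<dots> \<le> \<sigma> * b"
      proof -
        have "\<sigma> * (t * (r - c)) \<le> \<sigma> * b" using tb \<sigma> by (intro mult_left_mono) auto
        moreover have "\<sigma>\<^sup>2 \<ge> 0" "\<sigma>\<^sup>2 * t\<^sup>2 \<ge> 0" by auto
        ultimately show ?thesis by linarith
      qed
      also have "\<dots> \<le> \<sigma>\<^sup>2 + b * \<sigma>" by (simp add: mult.commute)
      finally show ?thesis .
    qed
  qed
  also have "\<dots> \<le> R\<^sup>2 + b * R" using \<sigma> b by (intro add_mono power_mono mult_left_mono) auto
  finally show ?thesis using b br \<sigma> by (simp add: admissible_def b_def c_def r_def)
qed

theorem mainTheorem14:
  fixes W :: "real \<Rightarrow> complex" and \<sigma>s \<sigma> \<sigma>' :: real and s :: complex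
  assumes "gevrey \<sigma>s 2 W"
    and "0 < \<sigma>" and "\<sigma> < \<sigma>'" and "\<sigma>' < \<sigma>s"
    and "s \<in> Omega \<sigma> \<inter> Omega \<sigma>'"
  shows "cdim {u \<in> Dsp W s \<sigma>. Lop W s u = (\<lambda>x. 0)} = cdim {u \<in> Dsp W s \<sigma>'. Lop W s u = (\<lambda>x. 0)}"
proof -
  have adm: "admissible s R" if "\<sigma> \<le> R" "R \<le> \<sigma>'" for R
    using assms that by (intro Omega_admissible[of s \<sigma> \<sigma>']) auto
  have "u \<in> Xsp \<sigma> \<longleftrightarrow> u \<in> Xsp \<sigma>'" if "Lop W s u = (\<lambda>x. 0)" for u
    using kernel_regularity[OF assms(1), of \<sigma> \<sigma>' s u] kernel_regularity[OF assms(1), of \<sigma>' \<sigma> s u] assms adm that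
    by (auto simp: min_def max_def)
  \<comment> \<open>The kernels agree as sets, not only in dimension, since the zero function lies
    in both target spaces.\<close>
  then have "{u \<in> Dsp W s \<sigma>. Lop W s u = (\<lambda>x. 0)} = {u \<in> Dsp W s \<sigma>'. Lop W s u = (\<lambda>x. 0)}"
    by (auto simp: Dsp_def zero_in_Ysp)
  then show ?thesis by simp
qed

end
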